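(* Let $\mathbb{F}$ be a field of characteristic zero, let $\mathfrak{g}$ be a Lie algebra over $\mathbb{F}$ with a vector space decomposition $\mathfrak{g}=\mathfrak{g}^-\oplus\mathfrak{g}^+$ (the subspaces $\mathfrak{g}^\pm$ need not be subalgebras), let $s,t$ be commuting formal variables commuting with $\mathfrak{g}$, and let $\pi^\pm:\mathfrak{g}[[s,t]]\to\mathfrak{g}^\pm[[s,t]]$ be the corresponding projections. Then the map $$C: s\mathfrak{g}^-[[s,t]]\times t\mathfrak{g}^+[[s,t]]\longrightarrow s\mathfrak{g}^-[[s,t]]\oplus t\mathfrak{g}^+[[s,t]]$$ defined by the Campbell-Baker-Hausdorff formula and given by $$e^{sg^-}e^{tg^+}=e^{C(sg^-,tg^+)}\qquad\text{for } g^\pm\in\mathfrak{g}^\pm[[s,t]]$$ is a bijection. The lowest order terms of $C(sg^-,tg^+)$ are described by $$C(sg^-,tg^+)=sg^-+tg^++st\,\tfrac12[g^-,g^+]+st\,q(s,t),$$ where $q(s,t)\in\mathfrak{g}[[s,t]]$ and $q(0,0)=0$. Moreover, for $h^\pm\in\mathfrak{g}^\pm[[s,t]]$, writing $C^{-1}(sh^-+th^+)=(sg^-,tg^+)$ with $g^\pm\in\mathfrak{g}^\pm[[s,t]]$, the lowest order terms are described by $$g^-=h^-+\tfrac12 t\,\pi^-([h^+,h^-])+t\,r^-(s,t),$$ $$g^+=h^++\tfrac12 s\,\pi^+([h^+,h^-])+s\,r^+(s,t),$$ where $r^\pm(s,t)\in\mathfrak{g}^\pm[[s,t]]$ and $r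^\pm(0,0)=0$.
   Context: $\mathfrak{g}[[s,t]]$ is the Lie algebra of formal power series in $s,t$ with coefficients in $\mathfrak{g}$ (bracket extended $\mathbb{F}[[s,t]]$-bilinearly), and $\mathfrak{g}[[s,t]]=\mathfrak{g}^-[[s,t]]\oplus\mathfrak{g}^+[[s,t]]$. The Campbell-Baker-Hausdorff series is the unique Lie series $C(a,b)\in\mathbb{Q}\langle\langle a,b\rangle\rangle$ in noncommuting symbols $a,b$ with $e^ae^b=e^{C(a,b)}$. Write $C(a,b)=\sum_{j,k\ge 0}H_{j,k}(a,b)$, where $H_{j,k}$ is the Lie polynomial homogeneous of degree $j$ in $a$ and degree $k$ in $b$. For $g_1,g_2\in\mathfrak{g}[[s,t]]$, the element $C(sg_1,tg_2)\in\mathfrak{g}[[s,t]]$ is obtained by substituting $a=sg_1$, $b=tg_2$ and evaluating all brackets in $\mathfrak{g}[[s,t]]$; this is well defined because $H_{j,k}(sg_1,tg_2)\in s^jt^k\mathfrak{g}[[s,t]]$. The exponentials $e^{sg_1}$, $e^{tg_2}$, $e^{C(sg_1,tg_2)}$ are elements of $U(\mathfrak{g})[[s,t]]$, where $U(\mathfrak{g})$ is the universal enveloping algebra. The domain of $C$ is the cartesian product of the two spaces, while the codomain is their direct sum viewed inside $\mathfrak{g}[[s,t]]$. *)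

theory Defs
  imports Complex_Main "HOL-Computational_Algebra.Formal_Power_Series"
begin

unbundle fps_syntax

section \<open>Lie algebras\<close>

locale lie_algebra = vector_space scale
  for scale :: "'f::field \<Rightarrow> 'a::ab_group_add \<Rightarrow> 'a" +
  fixes br :: "'a \<Rightarrow> 'a \<Rightarrow> 'a"
  assumes br_add_left: "br (x + y) z = br x z + br y z"
    and br_add_right: "br x (y + z) = br x y + br x z"
    and br_scale_left: "br (scale c x) y = scale c (br x y)"
    and br_scale_right: "br x (scale c y) = scale c (br x y)"
    and br_alternating: "br x x = 0"
    and br_jacobi: "br x (br y z) + br y (br z x) + br z (br x y) = 0"

locale decomposed_lie_algebra = lie_algebra scale br
  for scale :: "'f::field \<Rightarrow> 'a::ab_group_add \<Rightarrow> 'a" and br +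
  fixes gm gp :: "'a set"
  assumes subspace_gm: "subspace gm"
    and subspace_gp: "subspace gp"
    and gm_gp_disjoint: "gm \<inter> gp = {0}"
    and gm_gp_sum: "\<exists>u\<in>gm. \<exists>v\<in>gp. x = u + v"

text \<open>The projection of \<open>V \<oplus> W\<close> onto its summand \<open>V\<close>.\<close>

definition proj_along :: "'a::ab_group_add set \<Rightarrow> 'a set \<Rightarrow> 'a \<Rightarrow> 'a" where
  "proj_along V W x = (THE u. u \<in> V \<and> x - u \<in> W)"


section \<open>Power series in two commuting variables\<close>

text \<open>
  Series in \<open>s, t\<close> with coefficients in a type \<open>'a\<close> are elements of \<open>'a fps fps\<close>; the coefficient
  of \<open>s\<^sup>i t\<^sup>j\<close> in \<open>f\<close> is \<open>f $ i $ j\<close>, that is, \<open>s\<close> is the variable of the outer series.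
\<close>

definition ps2 :: "(nat \<Rightarrow> nat \<Rightarrow> 'a) \<Rightarrow> 'a fps fps" where
  "ps2 c = Abs_fps (\<lambda>i. Abs_fps (\<lambda>j. c i j))"

definition ps_map :: "('a \<Rightarrow> 'b) \<Rightarrow> 'a fps fps \<Rightarrow> 'b fps fps" where
  "ps_map h f = ps2 (\<lambda>i j. h (f $ i $ j))"

definition series_in :: "'a set \<Rightarrow> 'a fps fps set" where
  "series_in V = {f. \<forall>i j. f $ i $ j \<in> V}"

text \<open>Multiplication by \<open>s\<^sup>a t\<^sup>b\<close>, where the coefficients need not form a ring.\<close>

definition st_mult :: "nat \<Rightarrow> nat \<Rightarrow> 'a::zero fps fps \<Rightarrow> 'a fps fps" where
  "st_mult a b f = ps2 (\<lambda>i j. if a \<le> i \<and> b \<le> j then f $ (i - a) $ (j - b) else 0)"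

abbreviation s_mult :: "'a::zero fps fps \<Rightarrow> 'a fps fps" where "s_mult \<equiv> st_mult 1 0"
abbreviation t_mult :: "'a::zero fps fps \<Rightarrow> 'a fps fps" where "t_mult \<equiv> st_mult 0 1"

definition ps_bracket ::
    "('a \<Rightarrow> 'a \<Rightarrow> 'a::ab_group_add) \<Rightarrow> 'a fps fps \<Rightarrow> 'a fps fps \<Rightarrow> 'a fps fps" where
  "ps_bracket br f g =
     ps2 (\<lambda>m n. \<Sum>i\<le>m. \<Sum>j\<le>n. br (f $ i $ j) (g $ (m - i) $ (n - j)))"


section \<open>Power series in noncommuting symbols\<close>

text \<open>
  \<open>('x, 'c) ncfps\<close> is the ring of formal power series in the noncommuting symbols \<open>'x\<close>: a series
  assigns a coefficient to each word.
\<close>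

typedef (overloaded) ('x, 'c) ncfps = "UNIV :: ('x list \<Rightarrow> 'c) set"
  morphisms nc_nth Abs_nc by simp

lemma nc_nth_Abs [simp]: "nc_nth (Abs_nc f) = f"
  by (simp add: Abs_nc_inverse)

lemma nc_eqI: "(\<And>w. nc_nth p w = nc_nth q w) \<Longrightarrow> p = q"
  by (rule iffD1[OF nc_nth_inject]) (rule ext)

instantiation ncfps :: (type, ring_1) ring_1
begin

definition zero_ncfps where "0 = Abs_nc (\<lambda>w. 0)"
definition one_ncfps where "1 = Abs_nc (\<lambda>w. if w = [] then 1 else 0)"
definition plus_ncfps where "p + q = Abs_nc (\<lambda>w. nc_nth p w + nc_nth q w)"
definition minus_ncfps where "p - q = Abs_nc (\<lambda>w. nc_nth p w - nc_nth q w)"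
definition uminus_ncfps where "- p = Abs_nc (\<lambda>w. - nc_nth p w)"
definition times_ncfps where
  "p * q = Abs_nc (\<lambda>w. \<Sum>i=0..length w. nc_nth p (take i w) * nc_nth q (drop i w))"

instance
proof
  fix p q r :: "('a, 'b) ncfps"
  show "p * q * r = p * (q * r)"
  proof (rule nc_eqI)
    fix w
    define f where "f a b c = nc_nth p (take a w) * nc_nth q (take b (drop a w)) *
      nc_nth r (drop (a + b) w)" for a b c :: nat
    have "nc_nth (p * q * r) w = (\<Sum>j=0..length w. \<Sum>i=0..j. f i (j - i) (length w - j))"
      by (auto simp: times_ncfps_def f_def sum_distrib_right min_def drop_take
            split: if_splits intro!: sum.cong)
    also have "\<dots> = (\<Sum>j=0..length w. \<Sum>i=0..length w - j. f j i (length w - j - i))"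
      by (rule fps_mult_assoc_lemma)
    also have "\<dots> = nc_nth (p * (q * r)) w"
      by (auto simp: times_ncfps_def f_def sum_distrib_left mult.assoc add.commute intro!: sum.cong)
    finally show "nc_nth (p * q * r) w = nc_nth (p * (q * r)) w" .
  qed
  show "1 * p = p"
  proof (rule nc_eqI)
    fix w
    have "nc_nth (1 * p) w = (\<Sum>i=0..length w. if i = 0 then nc_nth p w else 0)"
      unfolding times_ncfps_def one_ncfps_def nc_nth_Abs by (rule sum.cong) (auto split: if_splits)
    then show "nc_nth (1 * p) w = nc_nth p w" by simp
  qed
  show "p * 1 = p"
  proof (rule nc_eqI)
    fix w
    have "nc_nth (p * 1) w = (\<Sum>i=0..length w. if i = length w then nc_nth p w else 0)"
      unfolding times_ncfps_def one_ncfps_def nc_nth_Abs by (rule sum.cong) (auto split: if_splits)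
    then show "nc_nth (p * 1) w = nc_nth p w" by simp
  qed
  have "nc_nth (0::('a, 'b) ncfps) [] \<noteq> nc_nth 1 []"
    by (simp add: zero_ncfps_def one_ncfps_def)
  then show "(0::('a, 'b) ncfps) \<noteq> 1"
    by (rule contrapos_nn) (rule arg_cong)
next
  fix a b c :: "('a, 'b) ncfps"
  note d = zero_ncfps_def plus_ncfps_def minus_ncfps_def uminus_ncfps_def
  show "a + b + c = a + (b + c)" by (rule nc_eqI) (simp add: d add.assoc)
  show "a + b = b + a" by (rule nc_eqI) (simp add: d add.commute)
  show "0 + a = a" by (rule nc_eqI) (simp add: d)
  show "- a + a = 0" by (rule nc_eqI) (simp add: d)
  show "a - b = a + - b" by (rule nc_eqI) (simp add: d)
  show "(a + b) * c = a * c + b * c"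
    by (rule nc_eqI) (simp add: d times_ncfps_def distrib_right sum.distrib)
  show "a * (b + c) = a * b + a * c"
    by (rule nc_eqI) (simp add: d times_ncfps_def distrib_left sum.distrib)
qed

end

definition nc_const :: "'c::ring_1 \<Rightarrow> ('x, 'c) ncfps" where
  "nc_const c = Abs_nc (\<lambda>w. if w = [] then c else 0)"

definition nc_var :: "'x \<Rightarrow> ('x, 'c::ring_1) ncfps" where
  "nc_var x = Abs_nc (\<lambda>w. if w = [x] then 1 else 0)"

text \<open>The elements of the free associative algebra.\<close>

definition nc_poly :: "('x, 'c::ring_1) ncfps \<Rightarrow> bool" where
  "nc_poly p \<longleftrightarrow> finite {w. nc_nth p w \<noteq> 0}"

text \<open>
  The exponential \<open>\<Sum>\<^sub>n p\<^sup>n / n!\<close> of a series without constant term: words of length \<open>l\<close> do not occur in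
  \<open>p\<^sup>n\<close> for \<open>n > l\<close>.
\<close>

definition nc_exp :: "('x, 'c::field_char_0) ncfps \<Rightarrow> ('x, 'c) ncfps" where
  "nc_exp p = Abs_nc (\<lambda>w. \<Sum>n\<le>length w. nc_nth (p ^ n) w / fact n)"


section \<open>The Campbell-Baker-Hausdorff series\<close>

datatype symb = SymA | SymB

datatype lie_expr =
    LieA | LieB | LieAdd lie_expr lie_expr | LieScale rat lie_expr | LieBr lie_expr lie_expr

text \<open>
  The range of \<open>nc_of_lie\<close> is the Lie subalgebra of \<open>\<rat>\<langle>a, b\<rangle>\<close> generated by \<open>a\<close> and \<open>b\<close>, that is, the set of
  Lie polynomials.
\<close>

primrec nc_of_lie :: "lie_expr \<Rightarrow> (symb, rat) ncfps" where
  "nc_of_lie LieA = nc_var SymA"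
| "nc_of_lie LieB = nc_var SymB"
| "nc_of_lie (LieAdd d e) = nc_of_lie d + nc_of_lie e"
| "nc_of_lie (LieScale c e) = nc_const c * nc_of_lie e"
| "nc_of_lie (LieBr d e) = nc_of_lie d * nc_of_lie e - nc_of_lie e * nc_of_lie d"

definition bihom_part :: "nat \<Rightarrow> nat \<Rightarrow> (symb, rat) ncfps \<Rightarrow> (symb, rat) ncfps" where
  "bihom_part j k p =
     Abs_nc (\<lambda>w. if count_list w SymA = j \<and> count_list w SymB = k then nc_nth p w else 0)"

definition lie_series :: "(symb, rat) ncfps \<Rightarrow> bool" where
  "lie_series p \<longleftrightarrow> (\<forall>j k. bihom_part j k p \<in> range nc_of_lie)"

definition cbh :: "(symb, rat) ncfps" where
  "cbh = (THE p. lie_series p \<and> nc_exp (nc_var SymA) * nc_exp (nc_var SymB) = nc_exp p)"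

text \<open>
  Evaluation of a Lie polynomial at \<open>a = x\<close>, \<open>b = y\<close> in \<open>\<gg>[[s,t]]\<close>.  The value does not depend on the
  expression representing the Lie polynomial, since the Lie polynomials form the free Lie algebra
  on \<open>a, b\<close>.
\<close>

primrec eval_lie_expr ::
    "('f::field_char_0 \<Rightarrow> 'a::ab_group_add \<Rightarrow> 'a) \<Rightarrow> ('a \<Rightarrow> 'a \<Rightarrow> 'a) \<Rightarrow>
     'a fps fps \<Rightarrow> 'a fps fps \<Rightarrow> lie_expr \<Rightarrow> 'a fps fps" where
  "eval_lie_expr scale br x y LieA = x"
| "eval_lie_expr scale br x y LieB = y"
| "eval_lie_expr scale br x y (LieAdd d e) =
     eval_lie_expr scale br x y d + eval_lie_expr scale br x y e"
| "eval_lie_expr scale br x y (LieScale c e) =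
     ps_map (scale (of_rat c)) (eval_lie_expr scale br x y e)"
| "eval_lie_expr scale br x y (LieBr d e) =
     ps_bracket br (eval_lie_expr scale br x y d) (eval_lie_expr scale br x y e)"

definition eval_lie_poly ::
    "('f::field_char_0 \<Rightarrow> 'a::ab_group_add \<Rightarrow> 'a) \<Rightarrow> ('a \<Rightarrow> 'a \<Rightarrow> 'a) \<Rightarrow>
     (symb, rat) ncfps \<Rightarrow> 'a fps fps \<Rightarrow> 'a fps fps \<Rightarrow> 'a fps fps" where
  "eval_lie_poly scale br p x y =
     (THE v. \<exists>e. nc_of_lie e = p \<and> v = eval_lie_expr scale br x y e)"

text \<open>
  \<open>C(x, y) = \<Sum>\<^sub>j\<^sub>,\<^sub>k H\<^sub>j\<^sub>,\<^sub>k(x, y)\<close> for \<open>x\<close> divisible by \<open>s\<close> and \<open>y\<close> divisible by \<open>t\<close>: as \<open>H\<^sub>j\<^sub>,\<^sub>k(x, y)\<close> is divisible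
  by \<open>s\<^sup>j t\<^sup>k\<close>, only the terms with \<open>j \<le> m\<close> and \<open>k \<le> n\<close> contribute to the coefficient of \<open>s\<^sup>m t\<^sup>n\<close>.
\<close>

definition cbh_map ::
    "('f::field_char_0 \<Rightarrow> 'a::ab_group_add \<Rightarrow> 'a) \<Rightarrow> ('a \<Rightarrow> 'a \<Rightarrow> 'a) \<Rightarrow>
     'a fps fps \<Rightarrow> 'a fps fps \<Rightarrow> 'a fps fps" where
  "cbh_map scale br x y =
     ps2 (\<lambda>m n. \<Sum>j\<le>m. \<Sum>k\<le>n. eval_lie_poly scale br (bihom_part j k cbh) x y $ m $ n)"


section \<open>The universal enveloping algebra\<close>

text \<open>
  \<open>U(\<gg>)\<close> is the quotient of the free associative algebra on the set \<open>\<gg>\<close> by the following two-sided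
  ideal.  The relations \<open>add\<close> and \<open>scale\<close> turn the free algebra on the set \<open>\<gg>\<close> into the tensor algebra
  of the vector space \<open>\<gg>\<close>.
\<close>

inductive_set uea_ideal ::
    "('f::field \<Rightarrow> 'a::ab_group_add \<Rightarrow> 'a) \<Rightarrow> ('a \<Rightarrow> 'a \<Rightarrow> 'a) \<Rightarrow> ('a, 'f) ncfps set"
  for scale br where
  add: "nc_var (x + y) - nc_var x - nc_var y \<in> uea_ideal scale br"
| scale: "nc_var (scale c x) - nc_const c * nc_var x \<in> uea_ideal scale br"
| bracket: "nc_var x * nc_var y - nc_var y * nc_var x - nc_var (br x y) \<in> uea_ideal scale br"
| plus: "p \<in> uea_ideal scale br \<Longrightarrow> q \<in> uea_ideal scale br \<Longrightarrow> p + q \<in> uea_ideal scale br"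
| left: "p \<in> uea_ideal scale br \<Longrightarrow> nc_poly u \<Longrightarrow> u * p \<in> uea_ideal scale br"
| right: "p \<in> uea_ideal scale br \<Longrightarrow> nc_poly u \<Longrightarrow> p * u \<in> uea_ideal scale br"

definition uea_class ::
    "('f::field \<Rightarrow> 'a::ab_group_add \<Rightarrow> 'a) \<Rightarrow> ('a \<Rightarrow> 'a \<Rightarrow> 'a) \<Rightarrow>
     ('a, 'f) ncfps \<Rightarrow> ('a, 'f) ncfps set" where
  "uea_class scale br p = {q. nc_poly q \<and> q - p \<in> uea_ideal scale br}"

text \<open>
  Computations in \<open>U(\<gg>)[[s,t]]\<close> are carried out on representatives, i.e. on series with coefficients in
  the free algebra; \<open>uea_series\<close> is the projection to \<open>U(\<gg>)[[s,t]]\<close>, a ring homomorphism.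
\<close>

definition uea_series ::
    "('f::field \<Rightarrow> 'a::ab_group_add \<Rightarrow> 'a) \<Rightarrow> ('a \<Rightarrow> 'a \<Rightarrow> 'a) \<Rightarrow>
     ('a, 'f) ncfps fps fps \<Rightarrow> ('a, 'f) ncfps set fps fps" where
  "uea_series scale br X = ps_map (uea_class scale br) X"

text \<open>
  A representative of \<open>e\<^sup>x = \<Sum>\<^sub>n x\<^sup>n / n!\<close> for \<open>x \<in> \<gg>[[s,t]]\<close> with zero constant term: the coefficient of
  \<open>s\<^sup>i t\<^sup>j\<close> in \<open>x\<^sup>n\<close> vanishes in \<open>U(\<gg>)\<close> for \<open>n > i + j\<close>.
\<close>

definition uea_exp :: "'a fps fps \<Rightarrow> ('a, 'f::field_char_0) ncfps fps fps" where
  "uea_exp x = ps2 (\<lambda>i j. \<Sum>n\<le>i + j. nc_const (1 / fact n) * (ps_map nc_var x ^ n) $ i $ j)"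

end

theory Submission
  imports Defs
begin

text \<open>
  Let \<open>z\<close> be the logarithm of \<open>e\<^sup>a e\<^sup>b\<close> and let \<open>\<partial>\<close> be the derivation that multiplies a word by its degree in \<open>a\<close>.
  Comparing \<open>\<partial>(e\<^sup>a e\<^sup>b) = a e\<^sup>a e\<^sup>b\<close> with the formula for the derivative of an exponential shows, degree by degree,
  that \<open>z\<close> is a Lie series.  For a Lie expression of degree \<open>n\<close>, replacing each word of its expansion in the
  free associative algebra by the right-normed bracket of the letters multiplies its value by \<open>n\<close> (Dynkin, Specht,
  Wever); so the value depends only on the expansion, and the components of \<open>C\<close> are explicit sums of iterated
  brackets.  Therefore \<open>C(x, y) - x - y\<close> is divisible by \<open>s t\<close>, and its coefficients depend only on coefficients of
  \<open>x, y\<close> of smaller total degree.  Since \<open>x\<close> and \<open>y\<close> are recovered from \<open>x + y\<close> by the projections, the equation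
  \<open>C(x, y) = u\<close> is a fixed point problem for a contraction in \<open>x + y\<close>.
\<close>

section \<open>Fixed points of contractions\<close>

text \<open>Both \<open>cbh\<close> and \<open>eval_lie_poly\<close> are definite descriptions, so
  nothing can be computed before existence and uniqueness are settled. That \<open>z\<close> is a
  Lie series, and that a Lie polynomial has a value independent of the chosen expression, are often
  drawn from Friedrichs' criterion and from the embedding of the free Lie algebra in the free
  associative one; here two degree arguments, resting on division by positive integers, take their
  place. Counting only the letter \<open>a\<close> makes the derivative of \<open>e^a e^b\<close> a
  left multiple of the product itself, whereas the total degree would bring in the conjugate
  \<open>e^a b e^(-a)\<close>. The price is that components without \<open>a\<close> are lost; they
  are recovered by setting \<open>a = 0\<close>, which turns \<open>e^z\<close> into
  \<open>e^b\<close>. Divisibility by \<open>s t\<close> reflects that an iterated bracket in a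
  single letter vanishes. The identity in \<open>U(g)[[s,t]]\<close> is carried over from
  \<open>Q<<a,b>>\<close> by substitution, as a congruence modulo the defining ideal of
  \<open>U(g)\<close>.\<close>

lemma graded_fixpoint:
  fixes F :: "('i \<Rightarrow> 'v) \<Rightarrow> 'i \<Rightarrow> 'v" and deg :: "'i \<Rightarrow> nat"
  assumes closed: "\<And>f. \<forall>i. f i \<in> S i \<Longrightarrow> \<forall>i. F f i \<in> S i"
    and start: "\<forall>i. f0 i \<in> S i"
    and contr: "\<And>f g i. \<forall>i. f i \<in> S i \<Longrightarrow> \<forall>i. g i \<in> S i \<Longrightarrow>
      (\<And>j. deg j < deg i \<Longrightarrow> f j = g j) \<Longrightarrow> F f i = F g i"
  obtains f where "\<forall>i. f i \<in> S i" "F f = f"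
proof -
  define it where "it k = (F ^^ k) f0" for k
  have it_Suc: "it (Suc k) = F (it k)" for k by (simp add: it_def)
  have it_S: "\<forall>i. it k i \<in> S i" for k
  proof (induction k)
    case 0
    then show ?case using start by (simp add: it_def)
  next
    case (Suc k)
    then show ?case unfolding it_Suc by (rule closed)
  qed
  \<comment> \<open>Values of degree \<open>d\<close> are determined by those of smaller degree, so
    index \<open>i\<close> is frozen from iterate \<open>deg i + 1\<close> on; the fixed point
    \<open>f\<close> below collects these frozen values.\<close>
  have it_stable: "it (Suc k) i = it k i" if "deg i < k" for k i
    using that
  proof (induction k arbitrary: i)
    case (Suc k)
    have "F (it (Suc k)) i = F (it k) i"
      by (rule contr[OF it_S it_S]) (use Suc in simp)
    then show ?case by (simp only: it_Suc)
  qed simp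
  have stable: "it l i = it k i" if "deg i < k" "k \<le> l" for k l i
    using that(2)
  proof (induction rule: dec_induct)
    case (step n)
    then have "deg i < n" using that(1) by simp
    then show ?case using step.IH it_stable[of i n] by (simp only:)
  qed simp
  define f where "f i = it (Suc (deg i)) i" for i
  have f_S: "\<forall>i. f i \<in> S i" using it_S by (simp add: f_def)
  have "F f i = f i" for i
  proof -
    have "F f i = F (it (deg i)) i"
    proof (rule contr[OF f_S it_S])
      show "f j = it (deg i) j" if "deg j < deg i" for j
        unfolding f_def by (rule stable[symmetric]) (use that in auto)
    qed
    then show ?thesis by (simp add: f_def it_Suc)
  qed
  then show thesis using f_S that by blast
qed

section \<open>Series in noncommuting symbols\<close>

lemma nc_nth_zero [simp]: "nc_nth 0 w = 0"
  by (simp add: zero_ncfps_def)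

lemma nc_nth_one: "nc_nth 1 w = (if w = [] then 1 else 0)"
  by (simp add: one_ncfps_def)

lemma nc_nth_add [simp]: "nc_nth (p + q) w = nc_nth p w + nc_nth q w"
  by (simp add: plus_ncfps_def)

lemma nc_nth_diff [simp]: "nc_nth (p - q) w = nc_nth p w - nc_nth q w"
  by (simp add: minus_ncfps_def)

lemma nc_nth_uminus [simp]: "nc_nth (- p) w = - nc_nth p w"
  by (simp add: uminus_ncfps_def)

lemma nc_nth_mult:
  "nc_nth (p * q) w = (\<Sum>i\<le>length w. nc_nth p (take i w) * nc_nth q (drop i w))"
  by (simp add: times_ncfps_def atLeast0AtMost)

lemma nc_nth_sum [simp]: "nc_nth (sum f A) w = (\<Sum>x\<in>A. nc_nth (f x) w)"
  by (induction A rule: infinite_finite_induct) auto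

lemma nc_nth_const: "nc_nth (nc_const c) w = (if w = [] then c else 0)"
  by (simp add: nc_const_def)

lemma nc_nth_var: "nc_nth (nc_var x) w = (if w = [x] then 1 else 0)"
  by (simp add: nc_var_def)

lemma nc_nth_const_mult [simp]: "nc_nth (nc_const c * p) w = c * nc_nth p w"
proof -
  have "nc_nth (nc_const c * p) w = (\<Sum>i\<le>length w. if i = 0 then c * nc_nth p w else 0)"
    unfolding nc_nth_mult nc_nth_const by (rule sum.cong) (auto split: if_splits)
  then show ?thesis by simp
qed

lemma nc_nth_mult_const [simp]: "nc_nth (p * nc_const c) w = nc_nth p w * c"
proof -
  have "nc_nth (p * nc_const c) w = (\<Sum>i\<le>length w. if i = length w then nc_nth p w * c else 0)"
    unfolding nc_nth_mult nc_nth_const by (rule sum.cong) (auto split: if_splits)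
  then show ?thesis by simp
qed

lemma nc_const_commute:
  fixes p :: "('x, 'c::comm_ring_1) ncfps"
  shows "p * nc_const c = nc_const c * p"
  by (rule nc_eqI) (simp add: mult.commute)

lemma nc_nth_Nil_mult [simp]: "nc_nth (p * q) [] = nc_nth p [] * nc_nth q []"
  by (simp add: nc_nth_mult)

lemma nc_nth_of_nat_mult [simp]: "nc_nth (of_nat n * p) w = of_nat n * nc_nth p w"
  by (induction n) (auto simp: algebra_simps)

section \<open>Order of a series with respect to word length\<close>

definition nc_ord_ge :: "nat \<Rightarrow> ('x, 'c::ring_1) ncfps \<Rightarrow> bool" where
  "nc_ord_ge n p \<longleftrightarrow> (\<forall>w. length w < n \<longrightarrow> nc_nth p w = 0)"

lemma nc_ord_ge_1: "nc_ord_ge (Suc 0) p \<longleftrightarrow> nc_nth p [] = 0"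
  by (simp add: nc_ord_ge_def)

lemma nc_ord_ge_add: "nc_ord_ge n p \<Longrightarrow> nc_ord_ge n q \<Longrightarrow> nc_ord_ge n (p + q)"
  by (simp add: nc_ord_ge_def)

lemma nc_ord_ge_diff: "nc_ord_ge n p \<Longrightarrow> nc_ord_ge n q \<Longrightarrow> nc_ord_ge n (p - q)"
  by (simp add: nc_ord_ge_def)

lemma nc_ord_ge_mult:
  assumes "nc_ord_ge m p" "nc_ord_ge n q"
  shows "nc_ord_ge (m + n) (p * q)"
proof -
  have "nc_nth p (take i w) * nc_nth q (drop i w) = 0" if "length w < m + n" "i \<le> length w" for w i
    using that assms by (cases "i < m") (auto simp: nc_ord_ge_def)
  then show ?thesis by (auto simp: nc_ord_ge_def nc_nth_mult intro!: sum.neutral)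
qed

lemma nc_ord_ge_power: "nc_nth p [] = 0 \<Longrightarrow> nc_ord_ge n (p ^ n)"
proof (induction n)
  case (Suc n)
  then show ?case using nc_ord_ge_mult[of "Suc 0" p n "p ^ n"] by (simp add: nc_ord_ge_1)
qed (simp add: nc_ord_ge_def)

lemma nc_nth_power_eq_0: "nc_nth p [] = 0 \<Longrightarrow> length w < n \<Longrightarrow> nc_nth (p ^ n) w = 0"
  using nc_ord_ge_power by (auto simp: nc_ord_ge_def)

text \<open>The difference of powers telescopes as
  \<open>p (p^(k+1) - q^(k+1)) + (p - q) q^(k+1)\<close>, and each factor beyond the first raises
  the order by one because the constant terms vanish. From exponent 2 on, powers agree to strictly
  higher order than \<open>p\<close> and \<open>q\<close>.\<close>

lemma nc_ord_ge_power_diff: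
  assumes "nc_nth p [] = 0" "nc_nth q [] = 0" "nc_ord_ge n (p - q)"
  shows "nc_ord_ge (n + k) (p ^ Suc k - q ^ Suc k)"
proof (induction k)
  case (Suc k)
  have "p ^ Suc (Suc k) - q ^ Suc (Suc k) = p * (p ^ Suc k - q ^ Suc k) + (p - q) * q ^ Suc k"
    by (simp add: algebra_simps)
  moreover have "nc_ord_ge (Suc 0 + (n + k)) (p * (p ^ Suc k - q ^ Suc k))"
    using assms Suc by (intro nc_ord_ge_mult) (auto simp: nc_ord_ge_1)
  moreover have "nc_ord_ge (n + Suc k) ((p - q) * q ^ Suc k)"
    using assms by (intro nc_ord_ge_mult nc_ord_ge_power)
  ultimately show ?case by (auto intro: nc_ord_ge_add)
qed (use assms in simp)

text \<open>In the coefficient of \<open>r * q\<close> at \<open>w\<close>, every splitting except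
  the last evaluates \<open>r\<close> on a shorter word; the last one contributes \<open>r\<close>
  at \<open>w\<close> times the constant term 1 of \<open>q\<close>.\<close>

lemma nc_mult_right_cancel:
  assumes "nc_nth q [] = 1" "p * q = p' * q"
  shows "p = p'"
proof (rule nc_eqI)
  define r where "r = p - p'"
  have rq: "r * q = 0" using assms(2) by (simp add: r_def left_diff_distrib)
  have "nc_nth r w = 0" for w
  proof (induction w rule: length_induct)
    case (1 w)
    have "(\<Sum>i\<le>length w. nc_nth r (take i w) * nc_nth q (drop i w)) =
        (\<Sum>i\<le>length w. if i = length w then nc_nth r w else 0)"
      by (intro sum.cong refl) (use 1 assms(1) in auto)
    then show ?case using rq nc_nth_mult[of r q w] by simp
  qed
  then show "nc_nth p w = nc_nth p' w" for w by (simp add: r_def)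
qed

section \<open>Exponential and logarithm of noncommutative series\<close>

lemma nc_exp_nth_extend:
  assumes "nc_nth p [] = 0" "length w \<le> N"
  shows "nc_nth (nc_exp p) w = (\<Sum>n\<le>N. nc_nth (p ^ n) w / fact n)"
  unfolding nc_exp_def nc_nth_Abs
  by (rule sum.mono_neutral_left) (use assms in \<open>auto simp: nc_nth_power_eq_0\<close>)

lemma nc_exp_nth_split:
  assumes "nc_nth p [] = 0"
  shows "nc_nth (nc_exp p) w =
    nc_nth 1 w + nc_nth p w + (\<Sum>n<length w. nc_nth (p ^ Suc (Suc n)) w / fact (Suc (Suc n)))"
proof -
  \<comment> \<open>The enlarged bound \<open>length w + 1\<close> leaves two summands to split off
    even when \<open>w\<close> is empty.\<close>
  have "nc_nth (nc_exp p) w = (\<Sum>n<Suc (Suc (length w)). nc_nth (p ^ n) w / fact n)"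
    using nc_exp_nth_extend[OF assms, of w "Suc (length w)"] by (simp only: lessThan_Suc_atMost)
  then show ?thesis
    by (subst (asm) sum.lessThan_Suc_shift, subst (asm) sum.lessThan_Suc_shift) (simp add: add.assoc)
qed

lemma nc_exp_Nil [simp]: "nc_nth (nc_exp p) [] = 1"
  by (simp add: nc_exp_def nc_nth_one)

text \<open>Besides the constant 1, only powers of exponent at least 2 remain, and their coefficient
  at \<open>w\<close> depends on shorter words alone. This gives both uniqueness and existence of
  logarithms.\<close>

lemma nc_exp_contraction:
  assumes "nc_nth p [] = 0" "nc_nth q [] = 0" "\<And>v. length v < length w \<Longrightarrow> nc_nth p v = nc_nth q v"
  shows "nc_nth (nc_exp p) w - nc_nth p w = nc_nth (nc_exp q) w - nc_nth q w"
proof -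
  have "nc_ord_ge (length w) (p - q)" using assms(3) by (simp add: nc_ord_ge_def)
  then have "nc_nth (p ^ Suc (Suc n)) w = nc_nth (q ^ Suc (Suc n)) w" for n
    using nc_ord_ge_power_diff[of p q "length w" "Suc n"] assms(1,2) by (auto simp: nc_ord_ge_def)
  then show ?thesis by (simp add: nc_exp_nth_split assms(1,2) del: power_Suc)
qed

lemma nc_exp_inject:
  assumes "nc_nth p [] = 0" "nc_nth q [] = 0" "nc_exp p = nc_exp q"
  shows "p = q"
proof (rule nc_eqI)
  show "nc_nth p w = nc_nth q w" for w
  proof (induction w rule: length_induct)
    case (1 w)
    then show ?case using nc_exp_contraction[of p q w] assms by simp
  qed
qed

text \<open>The equation is rewritten as \<open>p = u - (exp p - p)\<close>, whose right-hand side
  is contracting in the word length; no logarithm series is involved. The sets \<open>S\<close> keep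
  the constant term at 0.\<close>

lemma nc_exp_surj:
  fixes u :: "('x, 'c::field_char_0) ncfps"
  assumes "nc_nth u [] = 1"
  obtains p where "nc_nth p [] = 0" "nc_exp p = u"
proof -
  define F where "F f w = nc_nth u w - (nc_nth (nc_exp (Abs_nc f)) w - f w)" for f :: "'x list \<Rightarrow> 'c" and w
  define S :: "'x list \<Rightarrow> 'c set" where "S w = (if w = [] then {0} else UNIV)" for w
  have S: "(\<forall>w. f w \<in> S w) \<longleftrightarrow> f [] = 0" for f by (auto simp: S_def)
  obtain f where f: "\<forall>w. f w \<in> S w" "F f = f"
  proof (rule graded_fixpoint[of S F "\<lambda>_. 0" length])
    show "\<forall>w. F f w \<in> S w" if "\<forall>w. f w \<in> S w" for f
      using that assms unfolding S by (simp add: F_def)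
    show "F f w = F g w" if "\<forall>w. f w \<in> S w" "\<forall>w. g w \<in> S w"
      "\<And>v. length v < length w \<Longrightarrow> f v = g v" for f g w
      using that nc_exp_contraction[of "Abs_nc f" "Abs_nc g" w] unfolding S by (simp add: F_def)
  qed (auto simp: S_def)
  show thesis
  proof (rule that)
    show "nc_nth (Abs_nc f) [] = 0" using f(1) by (simp add: S)
    show "nc_exp (Abs_nc f) = u"
      by (rule nc_eqI) (use fun_cong[OF f(2)] in \<open>simp add: F_def algebra_simps\<close>)
  qed
qed

section \<open>The Campbell-Baker-Hausdorff series\<close>

lemma count_list_take_drop: "count_list (take i w) x + count_list (drop i w) x = count_list w x"
  by (metis append_take_drop_id count_list_append)

lemma count_symb: "count_list w SymA + count_list w SymB = length w"
proof (induction w)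
  case (Cons x w)
  then show ?case by (cases x) auto
qed simp

lemma bihom_part_nth:
  "nc_nth (bihom_part j k p) w =
    (if count_list w SymA = j \<and> count_list w SymB = k then nc_nth p w else 0)"
  by (simp add: bihom_part_def)

lemma bihom_part_diff: "bihom_part j k (p - q) = bihom_part j k p - bihom_part j k q"
  by (rule nc_eqI) (simp add: bihom_part_nth)

lemma bihom_part_mult:
  "bihom_part j k (p * q) = (\<Sum>i\<le>j. \<Sum>l\<le>k. bihom_part i l p * bihom_part (j - i) (k - l) q)"
proof (rule nc_eqI)
  fix w :: "symb list"
  let ?a = "\<lambda>t. count_list (take t w) SymA" and ?b = "\<lambda>t. count_list (take t w) SymB"
  let ?X = "\<lambda>t. if count_list w SymA = j \<and> count_list w SymB = k
    then nc_nth p (take t w) * nc_nth q (drop t w) else 0"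
  have ab: "count_list (drop t w) SymA = count_list w SymA - ?a t" "?a t \<le> count_list w SymA"
    "count_list (drop t w) SymB = count_list w SymB - ?b t" "?b t \<le> count_list w SymB" for t
    using count_list_take_drop[of t w SymA] count_list_take_drop[of t w SymB] by linarith+
  \<comment> \<open>A cut position \<open>t\<close> determines \<open>i\<close> and \<open>l\<close>
    as the letter counts of the prefix; the nested conditionals let the sums over \<open>l\<close>
    and \<open>i\<close> collapse to a single term.\<close>
  have "nc_nth (\<Sum>i\<le>j. \<Sum>l\<le>k. bihom_part i l p * bihom_part (j - i) (k - l) q) w =
      (\<Sum>i\<le>j. \<Sum>l\<le>k. \<Sum>t\<le>length w. if i = ?a t then if l = ?b t then ?X t else 0 else 0)"
    unfolding nc_nth_sum nc_nth_mult bihom_part_nth using ab by (intro sum.cong refl) (auto simp: eq_diff_iff)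
  also have "\<dots> = (\<Sum>i\<le>j. \<Sum>t\<le>length w. \<Sum>l\<le>k. if i = ?a t then if l = ?b t then ?X t else 0 else 0)"
    by (intro sum.cong refl sum.swap)
  also have "\<dots> = (\<Sum>t\<le>length w. \<Sum>i\<le>j. \<Sum>l\<le>k. if i = ?a t then if l = ?b t then ?X t else 0 else 0)"
    by (rule sum.swap)
  also have "\<dots> = (\<Sum>t\<le>length w. \<Sum>i\<le>j. if i = ?a t then if ?b t \<le> k then ?X t else 0 else 0)"
    by (intro sum.cong refl) simp
  also have "\<dots> = (\<Sum>t\<le>length w. ?X t)"
    by (intro sum.cong refl) (use ab in auto)
  also have "\<dots> = nc_nth (bihom_part j k (p * q)) w"
    by (auto simp: bihom_part_nth nc_nth_mult)
  finally show "nc_nth (bihom_part j k (p * q)) w =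
    nc_nth (\<Sum>i\<le>j. \<Sum>l\<le>k. bihom_part i l p * bihom_part (j - i) (k - l) q) w" ..
qed

lemma bihom_part_0_0: "nc_nth p [] = 0 \<Longrightarrow> bihom_part 0 0 p = 0"
proof (rule nc_eqI)
  show "nc_nth (bihom_part 0 0 p) w = nc_nth 0 w" if "nc_nth p [] = 0" for w
    using that count_symb[of w] by (auto simp: bihom_part_nth)
qed

section \<open>Closure properties of the Lie polynomials\<close>

abbreviation lie_polys :: "(symb, rat) ncfps set" where
  "lie_polys \<equiv> range nc_of_lie"

lemma lie_polys_add: "p \<in> lie_polys \<Longrightarrow> q \<in> lie_polys \<Longrightarrow> p + q \<in> lie_polys"
  by (auto simp flip: nc_of_lie.simps(3))

lemma lie_polys_scale: "p \<in> lie_polys \<Longrightarrow> nc_const c * p \<in> lie_polys"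
  by (auto simp flip: nc_of_lie.simps(4))

lemma lie_polys_bracket: "p \<in> lie_polys \<Longrightarrow> q \<in> lie_polys \<Longrightarrow> p * q - q * p \<in> lie_polys"
  by (auto simp flip: nc_of_lie.simps(5))

lemma lie_polys_zero: "0 \<in> lie_polys"
proof -
  have "nc_of_lie (LieScale 0 LieA) = 0" by (rule nc_eqI) simp
  then show ?thesis by (metis rangeI)
qed

lemma lie_polys_diff: "p \<in> lie_polys \<Longrightarrow> q \<in> lie_polys \<Longrightarrow> p - q \<in> lie_polys"
proof -
  assume "p \<in> lie_polys" "q \<in> lie_polys"
  then have "p + nc_const (-1) * q \<in> lie_polys" by (intro lie_polys_add lie_polys_scale)
  moreover have "p + nc_const (-1) * q = p - q" by (rule nc_eqI) simp
  ultimately show ?thesis by simp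
qed

lemma lie_polys_sum: "(\<And>x. x \<in> A \<Longrightarrow> f x \<in> lie_polys) \<Longrightarrow> sum f A \<in> lie_polys"
  by (induction A rule: infinite_finite_induct) (auto simp: lie_polys_zero lie_polys_add)

lemma nc_of_lie_Nil: "nc_nth (nc_of_lie e) [] = 0"
  by (induction e) (auto simp: nc_nth_var)

lemma lie_series_Nil: "lie_series p \<Longrightarrow> nc_nth p [] = 0"
proof -
  assume "lie_series p"
  then obtain e where "bihom_part 0 0 p = nc_of_lie e" unfolding lie_series_def by blast
  then have "nc_nth (bihom_part 0 0 p) [] = 0" by (simp add: nc_of_lie_Nil)
  then show ?thesis by (simp add: bihom_part_nth)
qed

section \<open>The derivative of the exponential\<close>

definition nc_ad :: "'r::ring_1 \<Rightarrow> 'r \<Rightarrow> 'r" where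
  "nc_ad z p = z * p - p * z"

text \<open>Left multiplication by \<open>z\<close> is \<open>ad z + R\<close> with \<open>R\<close>
  the right multiplication, and the two summands commute. The right-hand side is the binomial
  expansion of \<open>((ad z + R)^(N+1) - R^(N+1)) / ad z\<close>; induction avoids the formal
  division.\<close>

lemma sum_powers_conjugate:
  fixes z d :: "'r::ring_1"
  shows "(\<Sum>i\<le>N. z ^ i * d * z ^ (N - i)) =
    (\<Sum>m\<le>N. of_nat (Suc N choose Suc m) * ((nc_ad z ^^ m) d * z ^ (N - m)))"
proof (induction N)
  case 0
  then show ?case by simp
next
  case (Suc N)
  define A where "A m = (nc_ad z ^^ m) d" for m
  have zA: "z * A m = A (Suc m) + A m * z" for m by (simp add: A_def nc_ad_def)
  have "(\<Sum>i\<le>Suc N. z ^ i * d * z ^ (Suc N - i)) =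
      d * z ^ Suc N + z * (\<Sum>i\<le>N. z ^ i * d * z ^ (N - i))"
    by (subst sum.atMost_Suc_shift) (simp add: sum_distrib_left mult.assoc)
  also have "z * (\<Sum>i\<le>N. z ^ i * d * z ^ (N - i)) =
      (\<Sum>m\<le>N. of_nat (Suc N choose Suc m) * (A (Suc m) * z ^ (N - m))) +
      (\<Sum>m\<le>N. of_nat (Suc N choose Suc m) * (A m * z ^ (Suc N - m)))"
  proof -
    have "z * (of_nat c * (A m * z ^ (N - m))) =
        of_nat c * (A (Suc m) * z ^ (N - m)) + of_nat c * (A m * z ^ (Suc N - m))"
      if "m \<le> N" for m c
    proof -
      have "z * (of_nat c * (A m * z ^ (N - m))) = of_nat c * ((z * A m) * z ^ (N - m))"
        by (metis mult.assoc mult_of_nat_commute)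
      then show ?thesis using that by (simp add: zA Suc_diff_le algebra_simps)
    qed
    then show ?thesis
      unfolding Suc.IH A_def[symmetric] sum_distrib_left sum.distrib[symmetric]
      by (intro sum.cong refl) (simp del: binomial_Suc_Suc)
  qed
  \<comment> \<open>Both sums are brought to the range up to \<open>N + 1\<close> for Pascal's rule:
    the loose \<open>d * z ^ Suc N\<close> becomes the term \<open>m = 0\<close> of the first, and
    the second gains a term whose binomial coefficient is 0.\<close>
  also have "d * z ^ Suc N +
      ((\<Sum>m\<le>N. of_nat (Suc N choose Suc m) * (A (Suc m) * z ^ (N - m))) +
      (\<Sum>m\<le>N. of_nat (Suc N choose Suc m) * (A m * z ^ (Suc N - m)))) =
      (\<Sum>m\<le>Suc N. of_nat (Suc N choose m) * (A m * z ^ (Suc N - m))) +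
      (\<Sum>m\<le>Suc N. of_nat (Suc N choose Suc m) * (A m * z ^ (Suc N - m)))"
    by (subst sum.atMost_Suc_shift, subst sum.atMost_Suc)
      (simp add: A_def binomial_eq_0 del: binomial_Suc_Suc sum.atMost_Suc power_Suc)
  also have "\<dots> = (\<Sum>m\<le>Suc N. of_nat (Suc (Suc N) choose Suc m) * (A m * z ^ (Suc N - m)))"
    unfolding sum.distrib[symmetric] by (intro sum.cong refl) (simp add: algebra_simps)
  finally show ?case by (simp only: A_def)
qed

definition nc_euler :: "(symb, 'c::ring_1) ncfps \<Rightarrow> (symb, 'c) ncfps" where
  "nc_euler p = Abs_nc (\<lambda>w. of_nat (count_list w SymA) * nc_nth p w)"

lemma nc_euler_nth: "nc_nth (nc_euler p) w = of_nat (count_list w SymA) * nc_nth p w"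
  by (simp add: nc_euler_def)

lemma nc_euler_mult: "nc_euler (p * q) = nc_euler p * q + p * nc_euler q"
proof (rule nc_eqI)
  fix w
  have *: "of_nat (count_list w SymA) * (x * y) =
      of_nat (count_list (take i w) SymA) * x * y + x * (of_nat (count_list (drop i w) SymA) * y)"
    for i :: nat and x y :: 'a
  proof -
    have "of_nat (count_list (drop i w) SymA) * (x * y) = x * (of_nat (count_list (drop i w) SymA) * y)"
      by (metis mult.assoc mult_of_nat_commute)
    then show ?thesis
      unfolding count_list_take_drop[of i w SymA, symmetric] of_nat_add distrib_right
      by (simp add: mult.assoc)
  qed
  show "nc_nth (nc_euler (p * q)) w = nc_nth (nc_euler p * q + p * nc_euler q) w"
    unfolding nc_euler_nth nc_nth_mult nc_nth_add sum_distrib_left sum.distrib[symmetric]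
    by (intro sum.cong refl *)
qed

lemma nc_euler_power: "nc_euler (z ^ Suc N) = (\<Sum>i\<le>N. z ^ i * nc_euler z * z ^ (N - i))"
proof (induction N)
  case (Suc N)
  have "nc_euler (z ^ Suc (Suc N)) = nc_euler z * z ^ Suc N + z * nc_euler (z ^ Suc N)"
    by (simp only: power_Suc[of z "Suc N"] nc_euler_mult)
  then show ?case
    unfolding Suc.IH by (subst sum.atMost_Suc_shift) (simp add: sum_distrib_left mult.assoc)
qed simp

text \<open>\<open>dexp_left z d\<close> is \<open>\<phi>(ad z) d\<close> for \<open>\<phi>(u) = (e\<^sup>u - 1) / u\<close>.\<close>

definition dexp_left :: "('x, 'c::field_char_0) ncfps \<Rightarrow> ('x, 'c) ncfps \<Rightarrow> ('x, 'c) ncfps" where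
  "dexp_left z d = Abs_nc (\<lambda>w. \<Sum>m\<le>length w. nc_nth ((nc_ad z ^^ m) d) w / fact (Suc m))"

lemma nc_ad_ord_ge:
  assumes "nc_nth z [] = 0" "nc_nth d [] = 0"
  shows "nc_ord_ge (Suc m) ((nc_ad z ^^ m) d)"
proof (induction m)
  case (Suc m)
  have "nc_ord_ge (Suc 0) z" using assms by (simp add: nc_ord_ge_1)
  from nc_ord_ge_mult[OF this Suc] nc_ord_ge_mult[OF Suc this]
  have "nc_ord_ge (Suc (Suc m)) (z * (nc_ad z ^^ m) d)"
    "nc_ord_ge (Suc (Suc m)) ((nc_ad z ^^ m) d * z)" by simp_all
  then show ?case by (simp add: nc_ad_def[of z "(nc_ad z ^^ m) d"] nc_ord_ge_diff)
qed (use assms in \<open>simp add: nc_ord_ge_1\<close>)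

text \<open>The identity \<open>(N+1 choose m+1) / (N+1)! = 1 / ((m+1)! (N-m)!)\<close> separates
  the commutator part from the remaining power of \<open>z\<close>, so the derivative of the
  exponential series factors as a product of two series.\<close>

lemma nc_euler_exp:
  fixes z :: "(symb, 'c::field_char_0) ncfps"
  assumes "nc_nth z [] = 0"
  shows "nc_euler (nc_exp z) = dexp_left z (nc_euler z) * nc_exp z"
proof (rule nc_eqI)
  fix w :: "symb list"
  define L where "L = length w"
  define A where "A m = (nc_ad z ^^ m) (nc_euler z)" for m
  define T where "T m k = nc_nth (A m * z ^ k) w / (fact (Suc m) * fact k)" for m k
  have ordA: "nc_ord_ge (Suc m) (A m)" for m
    unfolding A_def by (rule nc_ad_ord_ge) (use assms in \<open>auto simp: nc_euler_nth\<close>)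
  have T0: "T m k = 0" if "L \<le> m + k" for m k
    using nc_ord_ge_mult[OF ordA nc_ord_ge_power[OF assms], of m k] that
    by (auto simp: T_def nc_ord_ge_def L_def)
  have "nc_nth (nc_euler (nc_exp z)) w =
      (\<Sum>n\<le>L. nc_nth (nc_euler (z ^ n)) w / fact n)"
    by (simp add: nc_euler_nth nc_exp_def sum_distrib_left L_def)
  also have "\<dots> = (\<Sum>n<Suc L. nc_nth (nc_euler (z ^ n)) w / fact n)"
    by (simp only: lessThan_Suc_atMost)
  also have "\<dots> = (\<Sum>N<L. nc_nth (nc_euler (z ^ Suc N)) w / fact (Suc N))"
    by (subst sum.lessThan_Suc_shift) (simp add: nc_euler_nth nc_nth_one)
  also have "\<dots> = (\<Sum>N<L. \<Sum>m\<le>N. T m (N - m))"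
  proof (intro sum.cong refl)
    fix N
    have "of_nat (Suc N choose Suc m) * x / fact (Suc N) = x / (fact (Suc m) * fact (N - m))"
      if "m \<le> N" for m and x :: 'c
      using that by (subst binomial_fact) (auto simp del: fact_Suc)
    then show "nc_nth (nc_euler (z ^ Suc N)) w / fact (Suc N) = (\<Sum>m\<le>N. T m (N - m))"
      unfolding nc_euler_power sum_powers_conjugate nc_nth_sum nc_nth_of_nat_mult
        sum_divide_distrib T_def A_def
      by (intro sum.cong refl) (simp del: fact_Suc binomial_Suc_Suc)
  qed
  also have "\<dots> = (\<Sum>(m, k)\<in>{(m, k). m + k < L}. T m k)"
    by (rule sum.triangle_reindex[symmetric])
  \<comment> \<open>Since \<open>A m * z ^ k\<close> has order at least \<open>m + k + 1\<close>,
    the triangle may be widened to a square, over which the two factors separate.\<close>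
  also have "\<dots> = (\<Sum>(m, k)\<in>{..L} \<times> {..L}. T m k)"
    by (rule sum.mono_neutral_left) (use T0 in \<open>auto simp flip: not_le\<close>)
  also have "\<dots> = (\<Sum>m\<le>L. \<Sum>k\<le>L. T m k)"
    by (simp add: sum.cartesian_product)
  also have "\<dots> = (\<Sum>i\<le>L. (\<Sum>m\<le>L. nc_nth (A m) (take i w) / fact (Suc m)) *
      (\<Sum>k\<le>L. nc_nth (z ^ k) (drop i w) / fact k))"
  proof -
    have "T m k = (\<Sum>i\<le>L. nc_nth (A m) (take i w) / fact (Suc m) * (nc_nth (z ^ k) (drop i w) / fact k))"
      for m k
      by (simp add: T_def nc_nth_mult L_def sum_divide_distrib del: fact_Suc)
    then have "(\<Sum>m\<le>L. \<Sum>k\<le>L. T m k) = (\<Sum>m\<le>L. \<Sum>i\<le>L. \<Sum>k\<le>L.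
        nc_nth (A m) (take i w) / fact (Suc m) * (nc_nth (z ^ k) (drop i w) / fact k))"
      by (simp only:) (intro sum.cong refl sum.swap)
    also have "\<dots> = (\<Sum>i\<le>L. \<Sum>m\<le>L. \<Sum>k\<le>L.
        nc_nth (A m) (take i w) / fact (Suc m) * (nc_nth (z ^ k) (drop i w) / fact k))"
      by (rule sum.swap)
    finally show ?thesis by (simp only: sum_product)
  qed
  also have "\<dots> = (\<Sum>i\<le>L. nc_nth (dexp_left z (nc_euler z)) (take i w) * nc_nth (nc_exp z) (drop i w))"
  proof (intro sum.cong refl arg_cong2[where f = "(*)"])
    fix i assume "i \<in> {..L}"
    then have i: "length (take i w) = i" "i \<le> L" by (auto simp: L_def)
    show "(\<Sum>m\<le>L. nc_nth (A m) (take i w) / fact (Suc m)) = nc_nth (dexp_left z (nc_euler z)) (take i w)"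
      unfolding dexp_left_def nc_nth_Abs i A_def[symmetric]
      by (rule sum.mono_neutral_right) (use ordA i in \<open>auto simp: nc_ord_ge_def\<close>)
    show "(\<Sum>k\<le>L. nc_nth (z ^ k) (drop i w) / fact k) = nc_nth (nc_exp z) (drop i w)"
      by (rule nc_exp_nth_extend[symmetric]) (use assms in \<open>auto simp: L_def\<close>)
  qed
  also have "\<dots> = nc_nth (dexp_left z (nc_euler z) * nc_exp z) w"
    by (simp add: nc_nth_mult L_def)
  finally show "nc_nth (nc_euler (nc_exp z)) w = nc_nth (dexp_left z (nc_euler z) * nc_exp z) w" .
qed

lemma sum_atMost_rev: "(\<Sum>i\<le>n. f (n - i)) = (\<Sum>i\<le>n. f i)" for n :: nat
  by (rule sum.reindex_bij_witness[of _ "\<lambda>i. n - i" "\<lambda>i. n - i"]) auto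

lemma bihom_part_nc_ad:
  "bihom_part j k (nc_ad p q) = (\<Sum>i\<le>j. \<Sum>l\<le>k. nc_ad (bihom_part i l p) (bihom_part (j - i) (k - l) q))"
proof -
  have "bihom_part j k (q * p) =
      (\<Sum>i\<le>j. \<Sum>l\<le>k. bihom_part (j - i) (k - l) q * bihom_part (j - (j - i)) (k - (k - l)) p)"
    unfolding bihom_part_mult
    by (subst sum_atMost_rev[symmetric], subst (2) sum_atMost_rev[symmetric]) (rule refl)
  also have "\<dots> = (\<Sum>i\<le>j. \<Sum>l\<le>k. bihom_part (j - i) (k - l) q * bihom_part i l p)"
    by (intro sum.cong refl) simp
  finally show ?thesis
    by (simp add: nc_ad_def bihom_part_diff bihom_part_mult[of _ _ p] sum_subtractf)
qed

text \<open>Knowledge below degree \<open>n\<close> suffices for a commutator in degree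
  \<open>n\<close> itself: the components of bidegree (0,0) vanish, so in every surviving term both
  factors have degree less than \<open>n\<close>.\<close>

lemma lie_polys_nc_ad:
  assumes "nc_nth p [] = 0" "nc_nth q [] = 0"
    and "\<And>j k. j + k < n \<Longrightarrow> bihom_part j k p \<in> lie_polys"
    and "\<And>j k. j + k < n \<Longrightarrow> bihom_part j k q \<in> lie_polys"
    and "j + k \<le> n"
  shows "bihom_part j k (nc_ad p q) \<in> lie_polys"
  unfolding bihom_part_nc_ad
proof (intro lie_polys_sum)
  fix i l assume il: "i \<in> {..j}" "l \<in> {..k}"
  consider "i + l = 0" | "(j - i) + (k - l) = 0" | "i + l < n" "(j - i) + (k - l) < n"
    using il assms(5) by fastforce
  then show "nc_ad (bihom_part i l p) (bihom_part (j - i) (k - l) q) \<in> lie_polys"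
  proof cases
    case 1
    then have "bihom_part i l p = 0" using assms(1) by (simp add: bihom_part_0_0)
    then show ?thesis by (simp add: nc_ad_def lie_polys_zero)
  next
    case 2
    then have "bihom_part (j - i) (k - l) q = 0" using assms(2) by (simp add: bihom_part_0_0)
    then show ?thesis by (simp add: nc_ad_def lie_polys_zero)
  next
    case 3
    then show ?thesis unfolding nc_ad_def by (intro lie_polys_bracket assms(3,4))
  qed
qed

lemma dexp_left_commuting:
  assumes "nc_ad z d = 0"
  shows "dexp_left z d = d"
proof (rule nc_eqI)
  have *: "(nc_ad z ^^ Suc m) d = 0" for m
    using assms by (induction m) (simp_all add: nc_ad_def)
  have "(nc_ad z ^^ m) d = (if m = 0 then d else 0)" for m
    using *[of "m - 1"] by (cases m) auto
  then have "nc_nth (dexp_left z d) w = (\<Sum>m\<le>length w. if m = 0 then nc_nth d w else 0)" for w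
    unfolding dexp_left_def nc_nth_Abs by (intro sum.cong refl) simp
  then show "nc_nth (dexp_left z d) w = nc_nth d w" for w by simp
qed

lemma nc_euler_exp_var:
  "nc_euler (nc_exp (nc_var SymA :: (symb, 'c::field_char_0) ncfps)) = nc_var SymA * nc_exp (nc_var SymA)"
  "nc_euler (nc_exp (nc_var SymB :: (symb, 'c) ncfps)) = 0"
proof -
  have "nc_euler (nc_var SymA) = (nc_var SymA :: (symb, 'c) ncfps)"
    "nc_euler (nc_var SymB) = (0 :: (symb, 'c) ncfps)"
    by (rule nc_eqI, simp add: nc_euler_nth nc_nth_var)+
  then show "nc_euler (nc_exp (nc_var SymA :: (symb, 'c) ncfps)) = nc_var SymA * nc_exp (nc_var SymA)"
    "nc_euler (nc_exp (nc_var SymB :: (symb, 'c) ncfps)) = 0"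
    by (simp_all add: nc_euler_exp nc_nth_var dexp_left_commuting nc_ad_def)
qed

text \<open>This is the substitution \<open>a = 0\<close>, a ring homomorphism that commutes with
  the exponential. It supplies the components of degree 0 in \<open>a\<close>, which
  \<open>nc_euler\<close> annihilates.\<close>

definition nc_kill_A :: "(symb, 'c::ring_1) ncfps \<Rightarrow> (symb, 'c) ncfps" where
  "nc_kill_A p = Abs_nc (\<lambda>w. if SymA \<in> set w then 0 else nc_nth p w)"

lemma nc_kill_A_nth: "nc_nth (nc_kill_A p) w = (if SymA \<in> set w then 0 else nc_nth p w)"
  by (simp add: nc_kill_A_def)

lemma nc_kill_A_mult: "nc_kill_A (p * q) = nc_kill_A p * nc_kill_A q"
proof (rule nc_eqI)
  fix w :: "symb list"
  have "set w = set (take i w) \<union> set (drop i w)" for i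
    by (metis append_take_drop_id set_append)
  then have split: "nc_nth (nc_kill_A p) (take i w) * nc_nth (nc_kill_A q) (drop i w) =
      (if SymA \<in> set w then 0 else nc_nth p (take i w) * nc_nth q (drop i w))" for i
    unfolding nc_kill_A_nth by (cases "SymA \<in> set (take i w)"; cases "SymA \<in> set (drop i w)") auto
  show "nc_nth (nc_kill_A (p * q)) w = nc_nth (nc_kill_A p * nc_kill_A q) w"
    unfolding nc_nth_mult[of "nc_kill_A p"] split by (simp add: nc_kill_A_nth nc_nth_mult)
qed

lemma nc_kill_A_power: "nc_kill_A (p ^ n) = nc_kill_A p ^ n"
proof (induction n)
  case 0
  show ?case by (rule nc_eqI) (auto simp: nc_kill_A_nth nc_nth_one)
qed (simp add: nc_kill_A_mult)

lemma nc_kill_A_exp: "nc_kill_A (nc_exp p) = nc_exp (nc_kill_A p)"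
  by (rule nc_eqI) (simp add: nc_exp_def nc_kill_A_nth flip: nc_kill_A_power)

lemma nc_exp_zero [simp]: "nc_exp 0 = 1"
  by (rule nc_eqI) (simp add: nc_exp_nth_split)

lemma bihom_part_var_in_lie_polys:
  "bihom_part j k (nc_var SymA) \<in> lie_polys" "bihom_part j k (nc_var SymB) \<in> lie_polys"
proof -
  have "bihom_part j k (nc_var SymA) = (if j = 1 \<and> k = 0 then nc_of_lie LieA else 0)"
    "bihom_part j k (nc_var SymB) = (if j = 0 \<and> k = 1 then nc_of_lie LieB else 0)"
    by (auto intro!: nc_eqI simp: bihom_part_nth nc_nth_var)
  then show "bihom_part j k (nc_var SymA) \<in> lie_polys" "bihom_part j k (nc_var SymB) \<in> lie_polys"
    by (auto simp del: nc_of_lie.simps simp: lie_polys_zero)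
qed

text \<open>
  Comparing \<open>\<partial>(e\<^sup>z) = \<phi>(ad z)(\<partial>z) e\<^sup>z\<close> with \<open>\<partial>(e\<^sup>a e\<^sup>b) = a e\<^sup>a e\<^sup>b\<close>, where \<open>\<partial>\<close> multiplies by the degree in \<open>a\<close>, gives
  \<open>\<partial>z = a - \<Sum>\<^sub>m\<^sub>\<ge>\<^sub>1 (ad z)\<^sup>m (\<partial>z) / (m + 1)!\<close>, which expresses each component of \<open>\<partial>z\<close> as a Lie polynomial in components of
  lower degree.
\<close>

lemma log_exp_mult_exp_lie:
  assumes z0: "nc_nth z [] = 0" and z: "nc_exp (nc_var SymA) * nc_exp (nc_var SymB) = nc_exp z"
  shows "lie_series z"
proof -
  define d where "d = nc_euler z"
  have d0: "nc_nth d [] = 0" by (simp add: d_def nc_euler_nth)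
  \<comment> \<open>The derivation annihilates \<open>e^b\<close>, so only the factor
    \<open>a\<close> of the derivative of \<open>e^a\<close> appears; \<open>e^z\<close> has
    constant term 1 and can be cancelled on the right.\<close>
  have "dexp_left z d * nc_exp z = nc_var SymA * nc_exp z"
    unfolding d_def nc_euler_exp[OF z0, symmetric]
    by (simp add: z[symmetric] nc_euler_mult nc_euler_exp_var mult.assoc)
  then have dexp: "dexp_left z d = nc_var SymA"
    by (rule nc_mult_right_cancel[rotated]) simp
  have "nc_kill_A (nc_exp (nc_var SymA) * nc_exp (nc_var SymB)) = nc_exp (nc_var SymB :: (symb, rat) ncfps)"
  proof -
    have "nc_kill_A (nc_var SymA) = (0 :: (symb, rat) ncfps)"
      "nc_kill_A (nc_var SymB) = (nc_var SymB :: (symb, rat) ncfps)"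
      by (auto intro!: nc_eqI simp: nc_kill_A_nth nc_nth_var)
    then show ?thesis by (simp add: nc_kill_A_mult nc_kill_A_exp)
  qed
  then have kill: "nc_kill_A z = nc_var SymB"
    unfolding z nc_kill_A_exp by (rule nc_exp_inject[rotated 2]) (auto simp: nc_kill_A_nth z0 nc_nth_var)
  have "bihom_part j k z \<in> lie_polys" for j k
  proof (induction "j + k" arbitrary: j k rule: less_induct)
    case less
    define n where "n = j + k"
    have z_lie: "bihom_part j' k' z \<in> lie_polys" if "j' + k' < n" for j' k'
      using less that by (simp add: n_def)
    show ?case
    proof (cases "j = 0")
      case True
      have "bihom_part 0 k z = bihom_part 0 k (nc_kill_A z)"
        by (rule nc_eqI) (auto simp: bihom_part_nth nc_kill_A_nth count_list_0_iff)
      then show ?thesis by (simp add: True kill bihom_part_var_in_lie_polys)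
    next
      case False
      have d_part: "bihom_part j' k' d = nc_const (of_nat j') * bihom_part j' k' z" for j' k'
        by (rule nc_eqI) (simp add: bihom_part_nth d_def nc_euler_nth)
      have ad0: "nc_nth ((nc_ad z ^^ m) d) [] = 0" for m
        using nc_ad_ord_ge[OF z0 d0, of m] by (simp add: nc_ord_ge_def)
      have d_lie: "bihom_part j' k' ((nc_ad z ^^ m) d) \<in> lie_polys" if "j' + k' < n" for m j' k'
        using that
      proof (induction m arbitrary: j' k')
        case 0
        then show ?case by (simp add: d_part lie_polys_scale z_lie)
      next
        case (Suc m)
        then show ?case
          unfolding funpow.simps comp_apply
          by (intro lie_polys_nc_ad[where n = n] z0 ad0 z_lie) auto
      qed
      \<comment> \<open>With one more bracket the full degree \<open>n\<close> is reached, because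
        only components below \<open>n\<close> of \<open>z\<close> and of the inner iterate
        enter.\<close>
      have ad_lie: "bihom_part j k ((nc_ad z ^^ Suc m) d) \<in> lie_polys" for m
        unfolding funpow.simps comp_apply
        by (intro lie_polys_nc_ad[where n = n] z0 ad0 z_lie d_lie) (auto simp: n_def)
      have "bihom_part j k d = bihom_part j k (nc_var SymA) -
          (\<Sum>m<n. nc_const (1 / fact (Suc (Suc m))) * bihom_part j k ((nc_ad z ^^ Suc m) d))"
      proof (rule nc_eqI)
        fix w :: "symb list"
        \<comment> \<open>The summand \<open>m = 0\<close> of \<open>dexp_left z d\<close> is
          \<open>d\<close> itself; the shift leaves exactly the iterated commutators with at least
          one bracket.\<close>
        have "nc_nth (nc_var SymA) w = nc_nth d w +
            (\<Sum>m<n. nc_nth ((nc_ad z ^^ Suc m) d) w / fact (Suc (Suc m)))" if "length w = n"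
          unfolding dexp[symmetric] dexp_left_def nc_nth_Abs that lessThan_Suc_atMost[symmetric]
          by (subst sum.lessThan_Suc_shift) simp
        then show "nc_nth (bihom_part j k d) w = nc_nth (bihom_part j k (nc_var SymA) -
            (\<Sum>m<n. nc_const (1 / fact (Suc (Suc m))) * bihom_part j k ((nc_ad z ^^ Suc m) d))) w"
          using count_symb[of w]
          by (auto simp: bihom_part_nth n_def simp del: fact_Suc funpow.simps)
      qed
      then have "bihom_part j k d \<in> lie_polys"
        by (simp only:) (intro lie_polys_diff lie_polys_sum lie_polys_scale bihom_part_var_in_lie_polys ad_lie)
      \<comment> \<open>The component of \<open>d\<close> is \<open>j\<close> times that of
        \<open>z\<close>, and \<open>j\<close> is nonzero in this case.\<close>
      then have "nc_const (1 / of_nat j) * bihom_part j k d \<in> lie_polys"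
        by (rule lie_polys_scale)
      moreover have "nc_const (1 / of_nat j) * bihom_part j k d = bihom_part j k z"
        by (rule nc_eqI) (simp add: d_part False)
      ultimately show ?thesis by simp
    qed
  qed
  then show ?thesis by (simp add: lie_series_def)
qed

text \<open>This justifies the definite description of \<open>cbh\<close>. A Lie series has no
  constant term, so injectivity of the exponential on such series gives uniqueness.\<close>

lemma cbh_unique_existence:
  "\<exists>!p. lie_series p \<and> nc_exp (nc_var SymA) * nc_exp (nc_var SymB) = nc_exp p"
proof -
  obtain z :: "(symb, rat) ncfps"
    where "nc_nth z [] = 0" "nc_exp z = nc_exp (nc_var SymA) * nc_exp (nc_var SymB)"
    by (rule nc_exp_surj[of "nc_exp (nc_var SymA) * nc_exp (nc_var SymB)"]) auto
  then show ?thesis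
    by (intro ex1I[of _ z]) (metis log_exp_mult_exp_lie, metis lie_series_Nil nc_exp_inject)
qed

lemma lie_series_cbh: "lie_series cbh"
  and exp_cbh: "nc_exp (nc_var SymA) * nc_exp (nc_var SymB) = nc_exp cbh"
  using theI'[OF cbh_unique_existence] unfolding cbh_def[symmetric] by auto

lemma cbh_Nil: "nc_nth cbh [] = 0"
  by (rule lie_series_Nil[OF lie_series_cbh])

text \<open>Coefficients of the defining equation are compared at words of length at most 2. At
  \<open>ab\<close> and \<open>ba\<close> the product has 1 and 0, while \<open>exp cbh\<close> has
  the unknown coefficient plus 1/2 from the square.\<close>

lemma cbh_low_order:
  "nc_nth cbh [SymA] = 1" "nc_nth cbh [SymB] = 1"
  "nc_nth cbh [SymA, SymB] = 1 / 2" "nc_nth cbh [SymB, SymA] = - 1 / 2"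
proof -
  have atMost2: "{..Suc (Suc 0)} = {0, 1, 2}" "{..Suc 0} = {0, 1}" by auto
  have exp1: "nc_nth (nc_exp p) [x] = nc_nth p [x]"
    and exp2: "nc_nth (nc_exp p) [x, y] = nc_nth p [x, y] + nc_nth p [x] * nc_nth p [y] / 2"
    if "nc_nth p [] = 0" for x y and p :: "(symb, rat) ncfps"
    using that by (simp_all add: nc_exp_def nc_nth_mult atMost2 nc_nth_one power2_eq_square)
  note var0 = nc_nth_var[of _ "[]", simplified]
  have eq: "nc_nth (nc_exp (nc_var SymA) * nc_exp (nc_var SymB)) w = nc_nth (nc_exp cbh) w" for w
    by (simp add: exp_cbh)
  show 1: "nc_nth cbh [SymA] = 1" "nc_nth cbh [SymB] = 1"
    using eq[of "[SymA]"] eq[of "[SymB]"]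
    by (simp_all add: nc_nth_mult atMost2 exp1[OF var0] exp1[OF cbh_Nil] nc_nth_var)
  show "nc_nth cbh [SymA, SymB] = 1 / 2" "nc_nth cbh [SymB, SymA] = - 1 / 2"
    using eq[of "[SymA, SymB]"] eq[of "[SymB, SymA]"]
    by (simp_all add: nc_nth_mult atMost2 exp1[OF var0] exp2[OF var0] exp2[OF cbh_Nil] nc_nth_var 1)
qed

section \<open>Lie algebras of power series\<close>

lemma (in lie_algebra) br_additive_left: "Modules.additive (\<lambda>x. br x z)"
  by unfold_locales (rule br_add_left)

lemma (in lie_algebra) br_additive_right: "Modules.additive (br z)"
  by unfold_locales (rule br_add_right)

lemmas (in lie_algebra) br_simps =
  br_add_left br_add_right br_scale_left br_scale_right
  additive.zero[OF br_additive_left] additive.zero[OF br_additive_right]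
  additive.minus[OF br_additive_left] additive.minus[OF br_additive_right]
  additive.diff[OF br_additive_left] additive.diff[OF br_additive_right]

lemmas (in lie_algebra) br_sum_left = additive.sum[OF br_additive_left]
lemmas (in lie_algebra) br_sum_right = additive.sum[OF br_additive_right]

lemma (in lie_algebra) br_anticommute: "br y x = - br x y"
proof -
  have "br x y + br y x = 0"
    using br_alternating[of "x + y"] unfolding br_add_left br_add_right
    by (simp add: br_alternating add.commute)
  then show ?thesis by (simp add: br_alternating eq_neg_iff_add_eq_0 add.commute)
qed

text \<open>The Jacobi identity in the form \<open>ad [x,y] = ad x ad y - ad y ad x\<close>, which
  lets commutators in the free associative algebra act as brackets.\<close>

lemma (in lie_algebra) br_br_left: "br (br x y) z = br x (br y z) - br y (br x z)"
proof -
  have "br (br x y) z = - br z (br x y)" by (rule br_anticommute)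
  moreover have "br y (br z x) = - br y (br x z)" by (subst br_anticommute) (simp add: br_simps)
  ultimately show ?thesis using br_jacobi[of x y z] by (simp add: algebra_simps add_eq_0_iff)
qed

definition fps_bracket :: "('a \<Rightarrow> 'a \<Rightarrow> 'a::ab_group_add) \<Rightarrow> 'a fps \<Rightarrow> 'a fps \<Rightarrow> 'a fps" where
  "fps_bracket br f g = Abs_fps (\<lambda>n. \<Sum>i\<le>n. br (f $ i) (g $ (n - i)))"

lemma fps_bracket_nth [simp]: "fps_bracket br f g $ n = (\<Sum>i\<le>n. br (f $ i) (g $ (n - i)))"
  by (simp add: fps_bracket_def)

lemma sum_triples:
  fixes n :: nat and f :: "nat \<Rightarrow> nat \<Rightarrow> nat \<Rightarrow> 'a::comm_monoid_add"
  shows "(\<Sum>i\<le>n. \<Sum>j\<le>n - i. f i j (n - i - j)) = (\<Sum>(i, j, k)\<in>{(i, j, k). i + j + k = n}. f i j k)"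
proof -
  have "(\<Sum>i\<le>n. \<Sum>j\<le>n - i. f i j (n - i - j)) = (\<Sum>(i, j)\<in>Sigma {..n} (\<lambda>i. {..n - i}). f i j (n - i - j))"
    by (simp add: sum.Sigma)
  also have "\<dots> = (\<Sum>(i, j, k)\<in>{(i, j, k). i + j + k = n}. f i j k)"
    by (rule sum.reindex_bij_witness[of _ "\<lambda>(i, j, k). (i, j)" "\<lambda>(i, j). (i, j, n - i - j)"]) auto
  finally show ?thesis .
qed

text \<open>One variable is treated alone because \<open>'a fps fps\<close> is obtained by applying
  the construction twice.\<close>

lemma lie_algebra_fps:
  fixes scale :: "'f::field_char_0 \<Rightarrow> 'a::ab_group_add \<Rightarrow> 'a"
  assumes "lie_algebra scale br"
  shows "lie_algebra (\<lambda>c f. Abs_fps (\<lambda>n. scale c (f $ n))) (fps_bracket br)"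
proof -
  interpret lie_algebra scale br by fact
  show ?thesis
  proof
    fix x y z :: "'a fps"
    show "fps_bracket br x x = 0"
    proof (rule fps_ext)
      fix n :: nat
      define s where "s = (\<Sum>i\<le>n. br (x $ i) (x $ (n - i)))"
      \<comment> \<open>Reversing the index and anticommutativity give \<open>s = - s\<close>;
        characteristic zero then forces \<open>s = 0\<close>.\<close>
      have "s = (\<Sum>i\<le>n. br (x $ (n - i)) (x $ (n - (n - i))))"
        unfolding s_def by (rule sum_atMost_rev[symmetric])
      also have "\<dots> = - s"
        unfolding s_def sum_negf[symmetric]
        by (intro sum.cong refl) (simp, rule br_anticommute)
      finally have "scale 2 s = 0"
        using scale_left_distrib[of 1 1 s] by (simp add: eq_neg_iff_add_eq_0)
      then have "s = 0" by simp
      then show "fps_bracket br x x $ n = 0 $ n" by (simp add: s_def)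
    qed
    show "fps_bracket br x (fps_bracket br y z) + fps_bracket br y (fps_bracket br z x) +
      fps_bracket br z (fps_bracket br x y) = 0"
    proof (rule fps_ext)
      fix n :: nat
      let ?T = "{(i, j, k). i + j + k = n}"
      have J: "fps_bracket br f (fps_bracket br g h) $ n =
          (\<Sum>(i, j, k)\<in>?T. br (f $ i) (br (g $ j) (h $ k)))" for f g h
        unfolding fps_bracket_nth br_sum_right by (rule sum_triples)
      \<comment> \<open>Cyclic renaming of the index triples aligns the three sums, so that the
        Jacobi identity of the coefficients applies to each triple.\<close>
      have rot1: "(\<Sum>(i, j, k)\<in>?T. f i j k) = (\<Sum>(i, j, k)\<in>?T. f j k i)"
        and rot2: "(\<Sum>(i, j, k)\<in>?T. f i j k) = (\<Sum>(i, j, k)\<in>?T. f k i j)"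
        for f :: "nat \<Rightarrow> nat \<Rightarrow> nat \<Rightarrow> 'a"
        by (rule sum.reindex_bij_witness[of _ "\<lambda>(i, j, k). (j, k, i)" "\<lambda>(i, j, k). (k, i, j)"]; auto)
          (rule sum.reindex_bij_witness[of _ "\<lambda>(i, j, k). (k, i, j)" "\<lambda>(i, j, k). (j, k, i)"]; auto)
      show "(fps_bracket br x (fps_bracket br y z) + fps_bracket br y (fps_bracket br z x) +
          fps_bracket br z (fps_bracket br x y)) $ n = 0 $ n"
        unfolding fps_add_nth J
        unfolding rot1[of "\<lambda>i j k. br (y $ i) (br (z $ j) (x $ k))"]
          rot2[of "\<lambda>i j k. br (z $ i) (br (x $ j) (y $ k))"] sum.distrib[symmetric]
        by (auto intro!: sum.neutral simp: br_jacobi)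
    qed
  qed (auto simp: fps_eq_iff br_simps scale_right_distrib scale_left_distrib scale_sum_right sum.distrib)
qed

lemma ps2_nth [simp]: "ps2 c $ i $ j = c i j"
  by (simp add: ps2_def)

lemma ps_map_nth [simp]: "ps_map h f $ i $ j = h (f $ i $ j)"
  by (simp add: ps_map_def)

lemma st_mult_nth: "st_mult a b f $ i $ j = (if a \<le> i \<and> b \<le> j then f $ (i - a) $ (j - b) else 0)"
  by (simp add: st_mult_def)

lemma ps_bracket_nth:
  "ps_bracket br f g $ m $ n = (\<Sum>i\<le>m. \<Sum>j\<le>n. br (f $ i $ j) (g $ (m - i) $ (n - j)))"
  by (simp add: ps_bracket_def)

lemma ps2_eq_iff: "f = g \<longleftrightarrow> (\<forall>i j. f $ i $ j = g $ i $ j)"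
  by (simp add: fps_eq_iff)

locale lie_algebra_char_0 = lie_algebra scale br
  for scale :: "'f::field_char_0 \<Rightarrow> 'a::ab_group_add \<Rightarrow> 'a" and br

lemma lie_algebra_char_0_ps:
  fixes scale :: "'f::field_char_0 \<Rightarrow> 'a::ab_group_add \<Rightarrow> 'a"
  assumes "lie_algebra_char_0 scale br"
  shows "lie_algebra_char_0 (\<lambda>c. ps_map (scale c)) (ps_bracket br)"
proof -
  have "(\<lambda>c. ps_map (scale c)) = (\<lambda>c f. Abs_fps (\<lambda>n. Abs_fps (\<lambda>m. scale c (f $ n $ m))))"
    by (simp add: fun_eq_iff ps_map_def ps2_def)
  moreover have "ps_bracket br = fps_bracket (fps_bracket br)"
    by (intro ext) (simp add: ps2_eq_iff ps_bracket_nth fps_sum_nth)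
  ultimately show ?thesis
    using lie_algebra_fps[OF lie_algebra_fps, of scale br] assms
    by (simp add: lie_algebra_char_0_def)
qed

section \<open>Evaluation of Lie polynomials\<close>

abbreviation words :: "nat \<Rightarrow> symb list set" where
  "words n \<equiv> {w. length w = n}"

lemma finite_words [simp]: "finite (words n)"
proof -
  have "(UNIV :: symb set) = {SymA, SymB}" by (auto intro: symb.exhaust)
  then have "finite (UNIV :: symb set)" by (metis finite.emptyI finite.insertI)
  from finite_lists_length_eq[OF this, of n] show ?thesis by simp
qed

lemma sum_words_split:
  fixes F :: "symb list \<Rightarrow> symb list \<Rightarrow> 'a::comm_monoid_add"
  shows "(\<Sum>w\<in>words n. \<Sum>i\<le>n. F (take i w) (drop i w)) =
    (\<Sum>i\<le>n. \<Sum>u\<in>words i. \<Sum>v\<in>words (n - i). F u v)"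
proof -
  have "(\<Sum>w\<in>words n. F (take i w) (drop i w)) = (\<Sum>u\<in>words i. \<Sum>v\<in>words (n - i). F u v)"
    if "i \<le> n" for i
    unfolding sum.cartesian_product
    by (rule sum.reindex_bij_witness[of _ "\<lambda>(u, v). u @ v" "\<lambda>w. (take i w, drop i w)"])
      (use that in auto)
  then show ?thesis by (subst sum.swap) simp
qed

context lie_algebra_char_0
begin

abbreviation qscale :: "rat \<Rightarrow> 'a \<Rightarrow> 'a" where
  "qscale c \<equiv> scale (of_rat c)"

text \<open>This repeats \<open>eval_lie_expr\<close> in an abstract Lie algebra. The locale is
  later interpreted at \<open>g[[s,t]]\<close> itself, which keeps the argument about brackets free
  of power series.\<close>

primrec lie_eval :: "'a \<Rightarrow> 'a \<Rightarrow> lie_expr \<Rightarrow> 'a" where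
  "lie_eval x y LieA = x"
| "lie_eval x y LieB = y"
| "lie_eval x y (LieAdd d e) = lie_eval x y d + lie_eval x y e"
| "lie_eval x y (LieScale c e) = qscale c (lie_eval x y e)"
| "lie_eval x y (LieBr d e) = br (lie_eval x y d) (lie_eval x y e)"

text \<open>The degree is that of the expression \<open>e\<close>; the Lie algebra itself is not graded.\<close>

primrec lie_part :: "'a \<Rightarrow> 'a \<Rightarrow> lie_expr \<Rightarrow> nat \<Rightarrow> 'a" where
  "lie_part x y LieA n = (if n = 1 then x else 0)"
| "lie_part x y LieB n = (if n = 1 then y else 0)"
| "lie_part x y (LieAdd d e) n = lie_part x y d n + lie_part x y e n"
| "lie_part x y (LieScale c e) n = qscale c (lie_part x y e n)"
| "lie_part x y (LieBr d e) n = (\<Sum>i\<le>n. br (lie_part x y d i) (lie_part x y e (n - i)))"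

lemma lie_eval_eq_sum_parts: "\<exists>M. (\<forall>n>M. lie_part x y e n = 0) \<and> lie_eval x y e = (\<Sum>n\<le>M. lie_part x y e n)"
proof (induction e)
  case LieA
  show ?case by (rule exI[of _ 1]) auto
next
  case LieB
  show ?case by (rule exI[of _ 1]) auto
next
  case (LieAdd d e)
  then obtain M N where
    M: "\<forall>n>M. lie_part x y d n = 0" "lie_eval x y d = (\<Sum>n\<le>M. lie_part x y d n)" and
    N: "\<forall>n>N. lie_part x y e n = 0" "lie_eval x y e = (\<Sum>n\<le>N. lie_part x y e n)"
    by blast
  have "lie_eval x y d = (\<Sum>n\<le>max M N. lie_part x y d n)"
    unfolding M(2) by (rule sum.mono_neutral_left) (use M(1) in auto)
  moreover have "lie_eval x y e = (\<Sum>n\<le>max M N. lie_part x y e n)"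
    unfolding N(2) by (rule sum.mono_neutral_left) (use N(1) in auto)
  ultimately show ?case
    by (intro exI[of _ "max M N"]) (use M(1) N(1) in \<open>simp add: sum.distrib\<close>)
next
  case (LieScale c e)
  then show ?case by (auto simp: scale_sum_right)
next
  case (LieBr d e)
  then obtain M N where
    M: "\<forall>n>M. lie_part x y d n = 0" "lie_eval x y d = (\<Sum>n\<le>M. lie_part x y d n)" and
    N: "\<forall>n>N. lie_part x y e n = 0" "lie_eval x y e = (\<Sum>n\<le>N. lie_part x y e n)"
    by blast
  let ?f = "\<lambda>i j. br (lie_part x y d i) (lie_part x y e j)"
  have f0: "?f i j = 0" if "i > M \<or> j > N" for i j
    using that M(1) N(1) by (auto simp: br_simps)
  have "lie_part x y (LieBr d e) n = 0" if "n > M + N" for n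
  proof -
    have "?f i (n - i) = 0" for i by (rule f0) (use that in linarith)
    then show ?thesis by simp
  qed
  moreover have "lie_eval x y (LieBr d e) = (\<Sum>n\<le>M + N. lie_part x y (LieBr d e) n)"
  proof -
    have "lie_eval x y (LieBr d e) = (\<Sum>(i, j)\<in>{..M} \<times> {..N}. ?f i j)"
      unfolding lie_eval.simps M(2) N(2) br_sum_left
      unfolding br_sum_right sum.cartesian_product ..
    also have "\<dots> = (\<Sum>(i, j)\<in>{(i, j). i + j \<le> M + N}. ?f i j)"
      by (rule sum.mono_neutral_left)
        (use f0 in \<open>auto simp flip: not_le intro: finite_subset[of _ "{..M + N} \<times> {..M + N}"]\<close>)
    also have "\<dots> = (\<Sum>n\<le>M + N. lie_part x y (LieBr d e) n)"
      by (simp add: sum.triangle_reindex_eq)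
    finally show ?thesis .
  qed
  ultimately show ?case by blast
qed

section \<open>Iterated brackets and the Dynkin-Specht-Wever lemma\<close>

definition letter :: "'a \<Rightarrow> 'a \<Rightarrow> symb \<Rightarrow> 'a" where
  "letter x y c = (case c of SymA \<Rightarrow> x | SymB \<Rightarrow> y)"

primrec word_ad :: "'a \<Rightarrow> 'a \<Rightarrow> symb list \<Rightarrow> 'a \<Rightarrow> 'a" where
  "word_ad x y [] z = z"
| "word_ad x y (c # w) z = br (letter x y c) (word_ad x y w z)"

primrec word_br :: "'a \<Rightarrow> 'a \<Rightarrow> symb list \<Rightarrow> 'a" where
  "word_br x y [] = 0"
| "word_br x y (c # w) = (if w = [] then letter x y c else br (letter x y c) (word_br x y w))"

lemma word_ad_append: "word_ad x y (u @ v) z = word_ad x y u (word_ad x y v z)"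
  by (induction u) auto

lemma word_br_append: "v \<noteq> [] \<Longrightarrow> word_br x y (u @ v) = word_ad x y u (word_br x y v)"
  by (induction u) auto

lemma word_ad_scale: "word_ad x y w (scale c z) = scale c (word_ad x y w z)"
  by (induction w) (auto simp: br_simps)

lemma word_ad_sum: "word_ad x y w (sum f A) = (\<Sum>i\<in>A. word_ad x y w (f i))"
  by (induction w) (auto simp: br_sum_right)

text \<open>For \<open>f = word_br x y\<close> this is the Dynkin operator on the component of
  degree \<open>n\<close>; for \<open>word_ad\<close> it is the adjoint action extended to the free
  associative algebra.\<close>

definition word_sum :: "nat \<Rightarrow> (symb, rat) ncfps \<Rightarrow> (symb list \<Rightarrow> 'a) \<Rightarrow> 'a" where
  "word_sum n p f = (\<Sum>w\<in>words n. qscale (nc_nth p w) (f w))"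

lemma word_sum_add: "word_sum n (p + q) f = word_sum n p f + word_sum n q f"
  by (simp add: word_sum_def of_rat_add scale_left_distrib sum.distrib)

lemma word_sum_diff: "word_sum n (p - q) f = word_sum n p f - word_sum n q f"
  by (simp add: word_sum_def of_rat_diff scale_left_diff_distrib sum_subtractf)

lemma word_sum_const_mult: "word_sum n (nc_const c * p) f = qscale c (word_sum n p f)"
  by (simp add: word_sum_def of_rat_mult scale_sum_right)

lemma word_sum_var: "word_sum n (nc_var c) f = (if n = 1 then f [c] else 0)"
proof -
  have "word_sum n (nc_var c) f = (\<Sum>w\<in>words n. if w = [c] then f [c] else 0)"
    unfolding word_sum_def nc_nth_var by (intro sum.cong refl) auto
  then show ?thesis by simp
qed

lemma word_sum_mult:
  "word_sum n (p * q) f =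
    (\<Sum>i\<le>n. \<Sum>u\<in>words i. qscale (nc_nth p u) (word_sum (n - i) q (\<lambda>v. f (u @ v))))"
proof -
  have "word_sum n (p * q) f = (\<Sum>w\<in>words n. \<Sum>i\<le>n.
      qscale (nc_nth p (take i w)) (qscale (nc_nth q (drop i w)) (f (take i w @ drop i w))))"
    unfolding word_sum_def
    by (intro sum.cong refl) (simp add: nc_nth_mult of_rat_sum of_rat_mult scale_sum_left)
  also have "\<dots> = (\<Sum>i\<le>n. \<Sum>u\<in>words i. \<Sum>v\<in>words (n - i).
      qscale (nc_nth p u) (qscale (nc_nth q v) (f (u @ v))))"
    by (rule sum_words_split)
  finally show ?thesis by (simp add: word_sum_def scale_sum_right)
qed

text \<open>Concatenation of words acts as composition of adjoint maps, so the expansion of a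
  bracket acts as a commutator of adjoint maps, which is the adjoint map of the bracket by
  \<open>br_br_left\<close>.\<close>

lemma word_sum_word_ad: "word_sum n (nc_of_lie e) (\<lambda>w. word_ad x y w z) = br (lie_part x y e n) z"
proof (induction e arbitrary: n z)
  case (LieBr d e)
  have prod: "word_sum n (nc_of_lie d * nc_of_lie e) (\<lambda>w. word_ad x y w z) =
      (\<Sum>i\<le>n. br (lie_part x y d i) (br (lie_part x y e (n - i)) z))"
    if "\<And>n z. word_sum n (nc_of_lie d) (\<lambda>w. word_ad x y w z) = br (lie_part x y d n) z"
      "\<And>n z. word_sum n (nc_of_lie e) (\<lambda>w. word_ad x y w z) = br (lie_part x y e n) z" for d e
  proof -
    have "word_sum m (nc_of_lie e) (\<lambda>v. word_ad x y u (word_ad x y v z)) =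
        word_ad x y u (br (lie_part x y e m) z)" for u m
      unfolding that(2)[symmetric] by (simp add: word_sum_def word_ad_sum word_ad_scale)
    then show ?thesis
      by (simp add: word_sum_mult word_ad_append that(1)[unfolded word_sum_def])
  qed
  have "(\<Sum>i\<le>n. br (lie_part x y e i) (br (lie_part x y d (n - i)) z)) =
      (\<Sum>i\<le>n. br (lie_part x y e (n - i)) (br (lie_part x y d i) z))"
    by (subst sum_atMost_rev[symmetric]) simp
  then show ?case
    by (simp add: word_sum_diff prod LieBr.IH br_sum_left br_br_left sum_subtractf)
qed (auto simp: word_sum_add word_sum_const_mult word_sum_var br_simps letter_def)

text \<open>Let \<open>D\<close> bracket words from the right. By the previous lemma and induction,
  \<open>D(d e) = ad d (D e) = deg(e) [d,e]\<close>, and likewise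
  \<open>D(e d) = - deg(d) [d,e]\<close>. The difference carries the factor
  \<open>deg(d) + deg(e)\<close>.\<close>

lemma word_sum_word_br: "word_sum n (nc_of_lie e) (word_br x y) = scale (of_nat n) (lie_part x y e n)"
proof (induction e arbitrary: n)
  case (LieBr d e)
  have prod: "word_sum n (nc_of_lie d * nc_of_lie e) (word_br x y) =
      (\<Sum>i\<le>n. scale (of_nat (n - i)) (br (lie_part x y d i) (lie_part x y e (n - i))))"
    if "\<And>n. word_sum n (nc_of_lie e) (word_br x y) = scale (of_nat n) (lie_part x y e n)" for d e
  proof -
    have "word_sum m (nc_of_lie e) (\<lambda>v. word_br x y (u @ v)) =
        word_ad x y u (scale (of_nat m) (lie_part x y e m))" for u m
    proof -
      have append: "qscale (nc_nth (nc_of_lie e) v) (word_br x y (u @ v)) =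
          qscale (nc_nth (nc_of_lie e) v) (word_ad x y u (word_br x y v))" for v
        by (cases "v = []") (auto simp: nc_of_lie_Nil word_br_append)
      show ?thesis
        unfolding that[symmetric] word_sum_def append word_ad_sum word_ad_scale ..
    qed
    then show ?thesis
      by (simp add: word_sum_mult word_sum_word_ad[unfolded word_sum_def] br_simps)
  qed
  have "(\<Sum>i\<le>n. scale (of_nat (n - i)) (br (lie_part x y e i) (lie_part x y d (n - i)))) =
      (\<Sum>i\<le>n. scale (of_nat i) (br (lie_part x y e (n - i)) (lie_part x y d i)))"
    by (subst sum_atMost_rev[symmetric]) simp
  also have "\<dots> = - (\<Sum>i\<le>n. scale (of_nat i) (br (lie_part x y d i) (lie_part x y e (n - i))))"
    unfolding sum_negf[symmetric] by (subst br_anticommute) simp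
  finally have "word_sum n (nc_of_lie (LieBr d e)) (word_br x y) =
      (\<Sum>i\<le>n. scale (of_nat (n - i)) (br (lie_part x y d i) (lie_part x y e (n - i))) +
        scale (of_nat i) (br (lie_part x y d i) (lie_part x y e (n - i))))"
    by (simp add: word_sum_diff prod LieBr.IH sum.distrib)
  also have "\<dots> = scale (of_nat n) (lie_part x y (LieBr d e) n)"
    by (simp add: scale_sum_right scale_left_distrib[symmetric] of_nat_add[symmetric] del: of_nat_add)
  finally show ?case .
qed (auto simp: word_sum_add word_sum_const_mult word_sum_var br_simps letter_def scale_right_distrib mult.commute)

lemma lie_part_0: "lie_part x y e 0 = 0"
  by (induction e) (auto simp: br_simps)

text \<open>The right-hand side sees \<open>e\<close> only through its expansion. In degree 0 both
  sides vanish, the scalar being 0 by the convention for division by zero.\<close>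

lemma lie_part_eq: "lie_part x y e n = scale (1 / of_nat n) (word_sum n (nc_of_lie e) (word_br x y))"
  by (cases "n = 0") (auto simp: word_sum_word_br lie_part_0)

text \<open>Well-definedness of the value of a Lie polynomial. The two expressions may have
  different degree bounds, hence the passage to the maximum.\<close>

lemma lie_eval_cong:
  assumes "nc_of_lie d = nc_of_lie e"
  shows "lie_eval x y d = lie_eval x y e"
proof -
  have eq: "lie_part x y d n = lie_part x y e n" for n
    by (simp add: lie_part_eq assms)
  obtain M N where
    M: "\<forall>n>M. lie_part x y d n = 0" "lie_eval x y d = (\<Sum>n\<le>M. lie_part x y d n)" and
    N: "\<forall>n>N. lie_part x y e n = 0" "lie_eval x y e = (\<Sum>n\<le>N. lie_part x y e n)"
    using lie_eval_eq_sum_parts by metis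
  have "(\<Sum>n\<le>M. lie_part x y d n) = (\<Sum>n\<le>max M N. lie_part x y d n)"
    by (rule sum.mono_neutral_left) (use M(1) in auto)
  moreover have "(\<Sum>n\<le>N. lie_part x y e n) = (\<Sum>n\<le>max M N. lie_part x y e n)"
    by (rule sum.mono_neutral_left) (use N(1) in auto)
  ultimately show ?thesis by (simp add: M(2) N(2) eq)
qed

text \<open>The expression may still contain terms of other degrees that cancel in the expansion; by
  \<open>lie_part_eq\<close> their total contribution to the value is zero.\<close>

lemma lie_eval_homogeneous:
  assumes "\<And>w. nc_nth (nc_of_lie e) w \<noteq> 0 \<Longrightarrow> length w = n"
  shows "lie_eval x y e = scale (1 / of_nat n) (word_sum n (nc_of_lie e) (word_br x y))"
proof -
  have 0: "lie_part x y e k = 0" if "k \<noteq> n" for k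
  proof -
    have "word_sum k (nc_of_lie e) (word_br x y) = 0"
      unfolding word_sum_def by (rule sum.neutral) (use assms that in force)
    then show ?thesis by (simp add: lie_part_eq)
  qed
  obtain M where M: "\<forall>n>M. lie_part x y e n = 0" "lie_eval x y e = (\<Sum>n\<le>M. lie_part x y e n)"
    using lie_eval_eq_sum_parts by metis
  have "(\<Sum>k\<le>M. lie_part x y e k) = (\<Sum>k\<le>M. if k = n then lie_part x y e n else 0)"
    by (intro sum.cong refl) (auto simp: 0)
  then show ?thesis using M by (cases "n \<le> M") (auto simp: lie_part_eq[symmetric])
qed

end

section \<open>Coefficients of the Campbell-Baker-Hausdorff map\<close>

lemma bihom_words_low:
  "{w. count_list w SymA = 0 \<and> count_list w SymB = 0} = {[]}"
  "{w. count_list w SymA = 1 \<and> count_list w SymB = 0} = {[SymA]}"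
  "{w. count_list w SymA = 0 \<and> count_list w SymB = 1} = {[SymB]}"
  "{w. count_list w SymA = 1 \<and> count_list w SymB = 1} = {[SymA, SymB], [SymB, SymA]}"
proof -
  have len: "length w = count_list w SymA + count_list w SymB" for w
    by (simp add: count_symb)
  show "{w. count_list w SymA = 0 \<and> count_list w SymB = 0} = {[]}"
  proof (intro set_eqI iffI)
    fix w
    assume "w \<in> {w. count_list w SymA = 0 \<and> count_list w SymB = 0}"
    then show "w \<in> {[]}" using len[of w] by simp
  qed simp
  have single: "w = [SymA] \<or> w = [SymB]" if "count_list w SymA + count_list w SymB = 1" for w
  proof -
    have "length w = Suc 0" using that len[of w] by linarith
    then obtain c where "w = [c]" by (auto simp: length_Suc_conv)
    then show ?thesis by (cases c) auto
  qed
  show "{w. count_list w SymA = 1 \<and> count_list w SymB = 0} = {[SymA]}"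
    "{w. count_list w SymA = 0 \<and> count_list w SymB = 1} = {[SymB]}"
  proof -
    have "w = [SymA]" if "count_list w SymA = 1" "count_list w SymB = 0" for w
      using single[of w] that by auto
    moreover have "w = [SymB]" if "count_list w SymA = 0" "count_list w SymB = 1" for w
      using single[of w] that by auto
    moreover have "count_list [SymA] SymA = 1" "count_list [SymA] SymB = 0"
      "count_list [SymB] SymA = 0" "count_list [SymB] SymB = 1" by simp_all
    ultimately show "{w. count_list w SymA = 1 \<and> count_list w SymB = 0} = {[SymA]}"
      "{w. count_list w SymA = 0 \<and> count_list w SymB = 1} = {[SymB]}"
      by blast+
  qed
  show "{w. count_list w SymA = 1 \<and> count_list w SymB = 1} = {[SymA, SymB], [SymB, SymA]}"
  proof (intro set_eqI iffI)
    fix w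
    assume w: "w \<in> {w. count_list w SymA = 1 \<and> count_list w SymB = 1}"
    then have "length w = Suc (Suc 0)" using len[of w] by simp
    then obtain c d where "w = [c, d]" by (auto simp: length_Suc_conv)
    then show "w \<in> {[SymA, SymB], [SymB, SymA]}" using w by (cases c; cases d) auto
  qed auto
qed

section \<open>Agreement of series up to a total degree in \<open>s\<close> and
  \<open>t\<close>\<close>

definition ps_agree :: "nat \<Rightarrow> 'a fps fps \<Rightarrow> 'a fps fps \<Rightarrow> bool" where
  "ps_agree d f g \<longleftrightarrow> (\<forall>i j. i + j < d \<longrightarrow> f $ i $ j = g $ i $ j)"

lemma ps_agree_mono: "ps_agree d f g \<Longrightarrow> d' \<le> d \<Longrightarrow> ps_agree d' f g"
  by (auto simp: ps_agree_def)

context lie_algebra_char_0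
begin

text \<open>The innermost bracket is that of an element with itself. Hence the components of
  \<open>C\<close> in one letter alone reduce to the linear terms.\<close>

lemma word_br_same_letter: "\<forall>d\<in>set w. d = c \<Longrightarrow> length w \<ge> 2 \<Longrightarrow> word_br x y w = 0"
proof (induction w)
  case (Cons d w)
  show ?case
  proof (cases "length w \<ge> 2")
    case True
    then show ?thesis using Cons by (auto simp: br_simps)
  next
    case False
    then obtain d' where "w = [d']" using Cons.prems by (cases w; cases "tl w") auto
    then show ?thesis using Cons.prems by (simp add: br_alternating)
  qed
qed simp

interpretation PS: lie_algebra_char_0 "\<lambda>c. ps_map (scale c)" "ps_bracket br"
  by (rule lie_algebra_char_0_ps) unfold_locales

lemma eval_lie_expr_eq: "eval_lie_expr scale br x y e = PS.lie_eval x y e"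
  by (induction e) auto

lemma eval_lie_poly_nc_of_lie: "eval_lie_poly scale br (nc_of_lie e) x y = eval_lie_expr scale br x y e"
  unfolding eval_lie_poly_def eval_lie_expr_eq
  by (rule the_equality) (auto intro: PS.lie_eval_cong)

text \<open>Dynkin's form of the component: its coefficients weight right-normed brackets, divided
  by the degree. The expression witnessing the Lie polynomial has disappeared.\<close>

lemma eval_cbh_part:
  "eval_lie_poly scale br (bihom_part j k cbh) x y =
    ps_map (scale (1 / of_nat (j + k))) (\<Sum>w\<in>{w. count_list w SymA = j \<and> count_list w SymB = k}.
      ps_map (qscale (nc_nth cbh w)) (PS.word_br x y w))"
proof -
  obtain e where e: "bihom_part j k cbh = nc_of_lie e"
    using lie_series_cbh unfolding lie_series_def by blast
  have "eval_lie_poly scale br (bihom_part j k cbh) x y = PS.lie_eval x y e"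
    by (simp add: e eval_lie_poly_nc_of_lie eval_lie_expr_eq)
  also have "\<dots> = ps_map (scale (1 / of_nat (j + k)))
      (PS.word_sum (j + k) (bihom_part j k cbh) (PS.word_br x y))"
    unfolding e
  proof (rule PS.lie_eval_homogeneous)
    fix w
    assume "nc_nth (nc_of_lie e) w \<noteq> 0"
    then show "length w = j + k"
      using count_symb[of w] by (simp add: e[symmetric] bihom_part_nth split: if_splits)
  qed
  also have "PS.word_sum (j + k) (bihom_part j k cbh) (PS.word_br x y) =
      (\<Sum>w\<in>{w. count_list w SymA = j \<and> count_list w SymB = k}.
        ps_map (qscale (nc_nth cbh w)) (PS.word_br x y w))"
    unfolding PS.word_sum_def using count_symb
    by (intro sum.mono_neutral_cong_right) (auto simp: bihom_part_nth PS.scale_zero_left)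
  finally show ?thesis .
qed

lemma eval_cbh_part_00: "eval_lie_poly scale br (bihom_part 0 0 cbh) x y = 0"
  unfolding eval_cbh_part bihom_words_low by (simp add: PS.scale_zero_right)

lemma eval_cbh_part_j0: "eval_lie_poly scale br (bihom_part j 0 cbh) x y = (if j = 1 then x else 0)"
proof (cases "j \<ge> 2")
  case True
  have "PS.word_br x y w = 0" if "count_list w SymA = j" "count_list w SymB = 0" for w
  proof (rule PS.word_br_same_letter)
    show "\<forall>d\<in>set w. d = SymA"
      using that(2) by (metis count_list_0_iff symb.exhaust)
    show "length w \<ge> 2" using True that count_symb[of w] by simp
  qed
  then show ?thesis using True unfolding eval_cbh_part
    by (simp add: PS.scale_zero_right)
next
  case False
  then consider "j = 0" | "j = 1" by linarith
  then show ?thesis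
  proof cases
    case 2
    then show ?thesis
      unfolding 2 eval_cbh_part bihom_words_low
      by (simp add: cbh_low_order PS.letter_def PS.scale_one)
  qed (simp add: eval_cbh_part_00)
qed

lemma eval_cbh_part_0k: "eval_lie_poly scale br (bihom_part 0 k cbh) x y = (if k = 1 then y else 0)"
proof (cases "k \<ge> 2")
  case True
  have "PS.word_br x y w = 0" if "count_list w SymA = 0" "count_list w SymB = k" for w
  proof (rule PS.word_br_same_letter)
    show "\<forall>d\<in>set w. d = SymB"
      using that(1) by (metis count_list_0_iff symb.exhaust)
    show "length w \<ge> 2" using True that count_symb[of w] by simp
  qed
  then show ?thesis using True unfolding eval_cbh_part
    by (simp add: PS.scale_zero_right)
next
  case False
  then consider "k = 0" | "k = 1" by linarith
  then show ?thesis
  proof cases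
    case 2
    then show ?thesis
      unfolding 2 eval_cbh_part bihom_words_low
      by (simp add: cbh_low_order PS.letter_def PS.scale_one)
  qed (simp add: eval_cbh_part_00)
qed

text \<open>The words \<open>ab\<close> and \<open>ba\<close> contribute \<open>[x,y] / 2\<close>
  and \<open>- [y,x] / 2\<close>, together \<open>[x,y]\<close>; the Dynkin factor
  \<open>1 / (1 + 1)\<close> leaves one half.\<close>

lemma eval_cbh_part_11:
  "eval_lie_poly scale br (bihom_part 1 1 cbh) x y = ps_map (scale (1 / 2)) (ps_bracket br x y)"
proof -
  have "eval_lie_poly scale br (bihom_part 1 1 cbh) x y = ps_map (scale (1 / 2))
      (ps_map (scale (1 / 2)) (ps_bracket br x y) + ps_map (scale (- 1 / 2)) (ps_bracket br y x))"
    unfolding eval_cbh_part bihom_words_low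
    by (simp add: cbh_low_order PS.letter_def of_rat_divide of_rat_minus)
  also have "ps_map (scale (1 / 2)) (ps_bracket br x y) + ps_map (scale (- 1 / 2)) (ps_bracket br y x) =
      ps_map (scale (1 / 2 + 1 / 2)) (ps_bracket br x y)"
    unfolding PS.scale_left_distrib PS.br_anticommute[of y x]
    by (simp add: PS.scale_minus_left PS.scale_minus_right)
  finally show ?thesis by (simp add: PS.scale_one)
qed

lemma cbh_map_nth:
  "cbh_map scale br x y $ m $ n =
    (\<Sum>j\<le>m. \<Sum>k\<le>n. eval_lie_poly scale br (bihom_part j k cbh) x y $ m $ n)"
  by (simp add: cbh_map_def)

text \<open>Only components without \<open>b\<close> reach the power \<open>t^0\<close>, and among
  them only the linear one survives. For \<open>m = 0\<close> the index 1 is out of range, which is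
  where the vanishing constant term enters.\<close>

lemma cbh_map_nth_0_right:
  assumes "x $ 0 $ 0 = 0"
  shows "cbh_map scale br x y $ m $ 0 = x $ m $ 0"
proof -
  have "cbh_map scale br x y $ m $ 0 = (\<Sum>j\<le>m. if j = 1 then x $ m $ 0 else 0)"
    unfolding cbh_map_nth by (intro sum.cong refl) (simp add: eval_cbh_part_j0)
  then show ?thesis using assms by (cases m) auto
qed

lemma cbh_map_nth_0_left:
  assumes "y $ 0 $ 0 = 0"
  shows "cbh_map scale br x y $ 0 $ n = y $ 0 $ n"
proof -
  have "cbh_map scale br x y $ 0 $ n = (\<Sum>k\<le>n. if k = 1 then y $ 0 $ n else 0)"
  proof -
    have "(\<Sum>k\<le>n. eval_lie_poly scale br (bihom_part 0 k cbh) x y $ 0 $ n) =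
        (\<Sum>k\<le>n. if k = 1 then y $ 0 $ n else 0)"
      by (intro sum.cong refl) (simp add: eval_cbh_part_0k)
    then show ?thesis by (simp add: cbh_map_nth)
  qed
  then show ?thesis using assms by (cases n) auto
qed

lemma cbh_map_nth_1_1:
  "cbh_map scale br x y $ 1 $ 1 = x $ 1 $ 1 + y $ 1 $ 1 + scale (1 / 2) (ps_bracket br x y $ 1 $ 1)"
proof -
  have "{..1::nat} = {0, 1}" by auto
  then show ?thesis
    unfolding cbh_map_nth
    using eval_cbh_part_11[of x y] eval_cbh_part_j0[of 1 x y] eval_cbh_part_0k[of 1 x y]
    by (simp add: eval_cbh_part_00)
qed

text \<open>The source of the contraction: with zero constant terms, a nonzero product of total
  degree at most \<open>d\<close> has both factors of degree at least 1, hence both of degree less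
  than \<open>d\<close>.\<close>

lemma ps_agree_bracket:
  assumes "ps_agree d f f'" "ps_agree d g g'"
    and "f $ 0 $ 0 = 0" "f' $ 0 $ 0 = 0" "g $ 0 $ 0 = 0" "g' $ 0 $ 0 = 0"
  shows "ps_agree (Suc d) (ps_bracket br f g) (ps_bracket br f' g')"
  unfolding ps_agree_def ps_bracket_nth
proof (intro allI impI sum.cong refl)
  fix m n i j
  assume mn: "m + n < Suc d" and ij: "i \<in> {..m}" "j \<in> {..n}"
  consider "i = 0 \<and> j = 0" | "m - i = 0 \<and> n - j = 0" | "i + j < d" "(m - i) + (n - j) < d"
    using mn ij by fastforce
  then show "br (f $ i $ j) (g $ (m - i) $ (n - j)) = br (f' $ i $ j) (g' $ (m - i) $ (n - j))"
    using assms by cases (auto simp: ps_agree_def br_simps)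
qed

lemma word_br_nth_0_0:
  assumes "x $ 0 $ 0 = 0" "y $ 0 $ 0 = 0"
  shows "PS.word_br x y w $ 0 $ 0 = 0"
  using assms by (induction w) (auto simp: PS.letter_def ps_bracket_nth br_simps split: symb.split)

text \<open>A degree is gained only through a bracket, hence the distinction by length; one gain is
  retained even when several brackets occur.\<close>

lemma ps_agree_word_br:
  assumes "ps_agree d x x'" "ps_agree d y y'"
    and "x $ 0 $ 0 = 0" "x' $ 0 $ 0 = 0" "y $ 0 $ 0 = 0" "y' $ 0 $ 0 = 0"
  shows "ps_agree (if length w \<ge> 2 then Suc d else d) (PS.word_br x y w) (PS.word_br x' y' w)"
proof (induction w)
  case (Cons c w)
  have letter: "ps_agree d (PS.letter x y c) (PS.letter x' y' c)"
    using assms by (cases c) (auto simp: PS.letter_def)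
  show ?case
  proof (cases "w = []")
    case True
    then show ?thesis using letter by simp
  next
    case False
    have "ps_agree d (PS.word_br x y w) (PS.word_br x' y' w)"
      by (rule ps_agree_mono[OF Cons.IH]) simp
    from ps_agree_bracket[OF letter this] False show ?thesis
      using assms by (auto simp: PS.letter_def word_br_nth_0_0 Suc_le_eq split: symb.split)
  qed
qed (simp add: ps_agree_def)

text \<open>After removal of the linear terms only brackets of words of length at least 2 remain,
  and their coefficient at \<open>s^m t^n\<close> depends on coefficients of total degree below
  \<open>m + n\<close>.\<close>

lemma cbh_map_contraction:
  assumes "ps_agree (m + n) x x'" "ps_agree (m + n) y y'"
    and "\<And>k. x $ 0 $ k = 0" "\<And>k. x' $ 0 $ k = 0" "\<And>k. y $ k $ 0 = 0" "\<And>k. y' $ k $ 0 = 0"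
  shows "(cbh_map scale br x y - x - y) $ m $ n = (cbh_map scale br x' y' - x' - y') $ m $ n"
proof -
  define E where "E x y j k = (if j + k \<ge> 2 then eval_lie_poly scale br (bihom_part j k cbh) x y else 0)"
    for x y j k
  have split: "eval_lie_poly scale br (bihom_part j k cbh) x y =
      E x y j k + (if k = 0 then if j = 1 then x else 0 else 0) + (if j = 0 then if k = 1 then y else 0 else 0)"
    for x y j k
  proof -
    consider "j + k \<ge> 2" | "k = 0" "j \<le> 1" | "j = 0" "k \<le> 1" by linarith
    then show ?thesis
    proof cases
      case 1
      then show ?thesis by (auto simp: E_def)
    next
      case 2
      then show ?thesis by (auto simp: E_def eval_cbh_part_j0)
    next
      case 3
      then show ?thesis by (auto simp: E_def eval_cbh_part_0k)
    qed
  qed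
  have sum: "(cbh_map scale br x y - x - y) $ m $ n = (\<Sum>j\<le>m. \<Sum>k\<le>n. E x y j k $ m $ n)"
    if "\<And>k. x $ 0 $ k = 0" "\<And>k. y $ k $ 0 = 0" for x y
  proof -
    have "cbh_map scale br x y $ m $ n = (\<Sum>j\<le>m. \<Sum>k\<le>n. E x y j k $ m $ n) +
        (\<Sum>j\<le>m. \<Sum>k\<le>n. if k = 0 then if j = 1 then x $ m $ n else 0 else 0) +
        (\<Sum>j\<le>m. \<Sum>k\<le>n. if j = 0 then if k = 1 then y $ m $ n else 0 else 0)"
      unfolding cbh_map_nth split sum.distrib[symmetric] by (intro sum.cong refl) auto
    \<comment> \<open>For \<open>m = 0\<close> the index \<open>j = 1\<close> is absent and the sum
      is 0, in accordance with divisibility of \<open>x\<close> by \<open>s\<close>.\<close>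
    also have "(\<Sum>j\<le>m. \<Sum>k\<le>n. if k = 0 then if j = 1 then x $ m $ n else 0 else 0) = x $ m $ n"
      using that by (cases m) auto
    also have "(\<Sum>j\<le>m. \<Sum>k\<le>n. if j = 0 then if k = 1 then y $ m $ n else 0 else 0) =
        (\<Sum>j\<le>m. if j = 0 then \<Sum>k\<le>n. if k = 1 then y $ m $ n else 0 else 0)"
      by (intro sum.cong refl) auto
    also have "\<dots> = y $ m $ n"
      using that by (cases n) auto
    finally show ?thesis by simp
  qed
  have "E x y j k $ m $ n = E x' y' j k $ m $ n" for j k
  proof (cases "j + k \<ge> 2")
    case True
    have "PS.word_br x y w $ m $ n = PS.word_br x' y' w $ m $ n"
      if "count_list w SymA = j" "count_list w SymB = k" for w
      using ps_agree_word_br[OF assms(1,2), of w] assms(3-6) True that count_symb[of w]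
      by (auto simp: ps_agree_def)
    then show ?thesis by (simp add: E_def eval_cbh_part fps_sum_nth)
  qed (simp add: E_def)
  then show ?thesis by (simp only: sum assms)
qed

end

section \<open>Substitution of power series for noncommuting symbols\<close>

lemma nc_const_add: "nc_const (a + b) = nc_const a + nc_const b"
  by (rule nc_eqI) (simp add: nc_nth_const)

lemma nc_const_diff: "nc_const (a - b) = nc_const a - nc_const b"
  by (rule nc_eqI) (simp add: nc_nth_const)

lemma nc_const_mult: "nc_const (a * b) = nc_const a * nc_const b"
  by (rule nc_eqI) (simp add: nc_nth_const)

lemma nc_const_0 [simp]: "nc_const 0 = 0"
  by (rule nc_eqI) (simp add: nc_nth_const)

lemma nc_const_1 [simp]: "nc_const 1 = 1"
  by (rule nc_eqI) (simp add: nc_nth_const nc_nth_one)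

lemma nc_const_sum: "nc_const (sum f A) = (\<Sum>x\<in>A. nc_const (f x))"
  by (induction A rule: infinite_finite_induct) (auto simp: nc_const_add)

lemma ps_mult_nth:
  fixes f g :: "'r::ring_1 fps fps"
  shows "(f * g) $ m $ n = (\<Sum>i\<le>m. \<Sum>j\<le>n. f $ i $ j * g $ (m - i) $ (n - j))"
  by (simp add: fps_mult_nth fps_sum_nth atLeast0AtMost)

text \<open>The truncation of \<open>uea_exp\<close> is kept for arbitrary representatives: as a
  finite formula in each coefficient it respects congruence modulo the ideal.\<close>

definition ps_exp :: "('x, 'f::field_char_0) ncfps fps fps \<Rightarrow> ('x, 'f) ncfps fps fps" where
  "ps_exp Z = ps2 (\<lambda>i j. \<Sum>n\<le>i + j. nc_const (1 / fact n) * (Z ^ n) $ i $ j)"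

lemma uea_exp_eq_ps_exp: "uea_exp x = ps_exp (ps_map nc_var x)"
  by (simp add: uea_exp_def ps_exp_def)

lemma finite_words_le [simp]: "finite {w :: symb list. length w \<le> N}"
proof -
  have "{w :: symb list. length w \<le> N} = (\<Union>n\<le>N. words n)" by auto
  then show ?thesis by simp
qed

lemma sum_words_le_split:
  fixes G :: "symb list \<Rightarrow> symb list \<Rightarrow> 'b::comm_monoid_add"
  assumes "\<And>u v. length u + length v > N \<Longrightarrow> G u v = 0"
  shows "(\<Sum>u | length u \<le> N. \<Sum>v | length v \<le> N. G u v) =
    (\<Sum>w | length w \<le> N. \<Sum>i\<le>length w. G (take i w) (drop i w))"
proof -
  have "(\<Sum>u | length u \<le> N. \<Sum>v | length v \<le> N. G u v) =
      (\<Sum>(u, v)\<in>{u. length u \<le> N} \<times> {v. length v \<le> N}. G u v)"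
    by (simp add: sum.cartesian_product)
  also have "\<dots> = (\<Sum>(u, v)\<in>{(u, v). length u + length v \<le> N}. G u v)"
    by (rule sum.mono_neutral_right) (use assms in \<open>auto simp flip: not_le\<close>)
  also have "\<dots> = (\<Sum>(w, i)\<in>Sigma {w. length w \<le> N} (\<lambda>w. {..length w}). G (take i w) (drop i w))"
    by (rule sum.reindex_bij_witness[of _ "\<lambda>(w, i). (take i w, drop i w)" "\<lambda>(u, v). (u @ v, length u)"])
      auto
  also have "\<dots> = (\<Sum>w | length w \<le> N. \<Sum>i\<le>length w. G (take i w) (drop i w))"
    by (simp add: sum.Sigma)
  finally show ?thesis .
qed

text \<open>Divisibility of \<open>X\<close> by \<open>s\<close> and of \<open>Y\<close> by
  \<open>t\<close> makes substitution for \<open>a\<close> and \<open>b\<close> converge: each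
  coefficient receives contributions from finitely many words.\<close>

locale ps_substitution =
  fixes X Y :: "('x, 'f::field_char_0) ncfps fps fps"
  assumes X_0: "X $ 0 $ j = 0" and Y_0: "Y $ i $ 0 = 0"
begin

primrec word_prod :: "symb list \<Rightarrow> ('x, 'f) ncfps fps fps" where
  "word_prod [] = 1"
| "word_prod (c # w) = (case c of SymA \<Rightarrow> X | SymB \<Rightarrow> Y) * word_prod w"

lemma word_prod_append: "word_prod (u @ v) = word_prod u * word_prod v"
  by (induction u) (auto simp: mult.assoc)

lemma word_prod_eq_0: "m < count_list w SymA \<or> n < count_list w SymB \<Longrightarrow> word_prod w $ m $ n = 0"
proof (induction w arbitrary: m n)
  case (Cons c w)
  have "(case c of SymA \<Rightarrow> X | SymB \<Rightarrow> Y) $ i $ j * word_prod w $ (m - i) $ (n - j) = 0"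
    if "i \<le> m" "j \<le> n" for i j
  proof (cases c)
    case SymA
    have "word_prod w $ (m - i) $ (n - j) = 0" if "i \<noteq> 0"
      by (rule Cons.IH) (use Cons.prems SymA that \<open>i \<le> m\<close> in auto)
    then show ?thesis using SymA X_0 by (cases "i = 0") auto
  next
    case SymB
    have "word_prod w $ (m - i) $ (n - j) = 0" if "j \<noteq> 0"
      by (rule Cons.IH) (use Cons.prems SymB that \<open>j \<le> n\<close> in auto)
    then show ?thesis using SymB Y_0 by (cases "j = 0") auto
  qed
  then show ?case by (simp add: ps_mult_nth)
qed simp

lemma word_prod_eq_0_length: "m + n < length w \<Longrightarrow> word_prod w $ m $ n = 0"
  using count_symb[of w] by (intro word_prod_eq_0) linarith

definition subst :: "(symb, rat) ncfps \<Rightarrow> ('x, 'f) ncfps fps fps" where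
  "subst p = ps2 (\<lambda>m n. \<Sum>w | length w \<le> m + n. nc_const (of_rat (nc_nth p w)) * word_prod w $ m $ n)"

lemma subst_nth:
  assumes "m + n \<le> N"
  shows "subst p $ m $ n = (\<Sum>w | length w \<le> N. nc_const (of_rat (nc_nth p w)) * word_prod w $ m $ n)"
  unfolding subst_def ps2_nth
  by (rule sum.mono_neutral_left) (use assms in \<open>auto simp: word_prod_eq_0_length not_le\<close>)

lemma subst_add: "subst (p + q) = subst p + subst q"
  by (simp add: ps2_eq_iff subst_def of_rat_add nc_const_add distrib_right sum.distrib)

lemma subst_diff: "subst (p - q) = subst p - subst q"
  by (simp add: ps2_eq_iff subst_def of_rat_diff nc_const_diff left_diff_distrib sum_subtractf)

lemma subst_const_mult: "subst (nc_const c * p) $ i $ j = nc_const (of_rat c) * subst p $ i $ j"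
  by (simp add: subst_def of_rat_mult nc_const_mult sum_distrib_left mult.assoc)

lemma subst_var: "subst (nc_var SymA) = X" "subst (nc_var SymB) = Y"
proof -
  have *: "subst (nc_var c) $ m $ n = (if 1 \<le> m + n then word_prod [c] $ m $ n else 0)" for c m n
  proof -
    have "subst (nc_var c) $ m $ n = (\<Sum>w | length w \<le> m + n. if w = [c] then word_prod [c] $ m $ n else 0)"
      unfolding subst_def ps2_nth nc_nth_var by (intro sum.cong refl) auto
    then show ?thesis by simp
  qed
  show "subst (nc_var SymA) = X" "subst (nc_var SymB) = Y"
    by (auto simp: ps2_eq_iff * X_0 Y_0 Suc_le_eq)
qed

lemma subst_one: "subst 1 = 1"
proof -
  have "subst 1 $ m $ n = (\<Sum>w\<in>{w :: symb list. length w \<le> m + n}. if w = [] then 1 $ m $ n else 0)" for m n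
    unfolding subst_def ps2_nth nc_nth_one by (intro sum.cong refl) auto
  then show ?thesis by (simp add: ps2_eq_iff)
qed

lemma subst_mult: "subst (p * q) = subst p * subst q"
  unfolding ps2_eq_iff
proof (intro allI)
  fix m n :: nat
  define N where "N = m + n"
  let ?P = "{..m} \<times> {..n}" and ?W = "{w :: symb list. length w \<le> N}"
  define c where "c r w = (nc_const (of_rat (nc_nth r w)) :: ('x, 'f) ncfps)" for r and w :: "symb list"
  define T where "T ij u v = c p u * word_prod u $ fst ij $ snd ij *
    (c q v * word_prod v $ (m - fst ij) $ (n - snd ij))" for ij u v
  define G where "G u v = c p u * c q v * word_prod (u @ v) $ m $ n" for u v
  have "(subst p * subst q) $ m $ n = (\<Sum>ij\<in>?P. \<Sum>u\<in>?W. \<Sum>v\<in>?W. T ij u v)"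
  proof -
    have prod: "subst p $ i $ j * subst q $ (m - i) $ (n - j) = (\<Sum>u\<in>?W. \<Sum>v\<in>?W. T (i, j) u v)"
      if "i \<le> m" "j \<le> n" for i j
    proof -
      have "i + j \<le> N" "(m - i) + (n - j) \<le> N" using that by (auto simp: N_def)
      then show ?thesis
        by (simp add: subst_nth sum_product T_def c_def)
    qed
    have "(subst p * subst q) $ m $ n = (\<Sum>i\<le>m. \<Sum>j\<le>n. \<Sum>u\<in>?W. \<Sum>v\<in>?W. T (i, j) u v)"
      unfolding ps_mult_nth by (intro sum.cong refl prod) auto
    also have "\<dots> = (\<Sum>(i, j)\<in>?P. \<Sum>u\<in>?W. \<Sum>v\<in>?W. T (i, j) u v)"
      by (rule sum.cartesian_product)
    finally show ?thesis by (simp only: case_prod_beta' prod.collapse)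
  qed
  also have "\<dots> = (\<Sum>u\<in>?W. \<Sum>ij\<in>?P. \<Sum>v\<in>?W. T ij u v)"
    by (rule sum.swap)
  also have "\<dots> = (\<Sum>u\<in>?W. \<Sum>v\<in>?W. \<Sum>ij\<in>?P. T ij u v)"
    by (intro sum.cong refl sum.swap)
  also have "\<dots> = (\<Sum>u\<in>?W. \<Sum>v\<in>?W. G u v)"
  proof (intro sum.cong refl)
    fix u v
    have "T ij u v = c p u * c q v *
        (word_prod u $ fst ij $ snd ij * word_prod v $ (m - fst ij) $ (n - snd ij))" for ij
    proof -
      have "word_prod u $ fst ij $ snd ij * (c q v * r) = c q v * (word_prod u $ fst ij $ snd ij * r)" for r
        unfolding c_def by (simp only: mult.assoc[symmetric] nc_const_commute)
      then show ?thesis by (simp add: T_def mult.assoc)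
    qed
    then show "(\<Sum>ij\<in>?P. T ij u v) = G u v"
      by (simp add: G_def word_prod_append ps_mult_nth sum_distrib_left[symmetric]
        sum.cartesian_product case_prod_beta)
  qed
  \<comment> \<open>Pairs of words of total length above \<open>N\<close> contribute nothing at
    \<open>s^m t^n\<close>, so the remaining pairs correspond to cut positions in words of length at
    most \<open>N\<close>.\<close>
  also have "\<dots> = (\<Sum>w\<in>?W. \<Sum>i\<le>length w. G (take i w) (drop i w))"
    by (rule sum_words_le_split) (simp add: G_def word_prod_eq_0_length N_def)
  also have "\<dots> = subst (p * q) $ m $ n"
  proof -
    have "(\<Sum>i\<le>length w. G (take i w) (drop i w)) = c (p * q) w * word_prod w $ m $ n" for w
      by (simp add: G_def c_def nc_nth_mult of_rat_sum of_rat_mult nc_const_sum nc_const_mult sum_distrib_right)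
    then show ?thesis by (simp add: subst_nth[of m n N] N_def c_def)
  qed
  finally show "subst (p * q) $ m $ n = (subst p * subst q) $ m $ n" ..
qed

lemma subst_power: "subst (p ^ n) = subst p ^ n"
  by (induction n) (auto simp: subst_one subst_mult)

text \<open>Only words of length at most \<open>m + n\<close> matter at \<open>s^m t^n\<close>, and
  for these the exponent bound of \<open>nc_exp\<close> can be raised uniformly to
  \<open>m + n\<close>, the bound used by \<open>ps_exp\<close>.\<close>

lemma subst_exp:
  assumes "nc_nth p [] = 0"
  shows "subst (nc_exp p) = ps_exp (subst p)"
  unfolding ps2_eq_iff
proof (intro allI)
  fix m n :: nat
  let ?W = "{w :: symb list. length w \<le> m + n}"
  have coeff: "nc_const (of_rat (nc_nth (nc_exp p) w) :: 'f) =
      (\<Sum>k\<le>m + n. nc_const (1 / fact k) * nc_const (of_rat (nc_nth (p ^ k) w)))"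
    if "length w \<le> m + n" for w
  proof -
    have "of_rat (fact k) = (fact k :: 'f)" for k
      by (metis of_nat_fact of_rat_of_nat_eq)
    then have "of_rat (x / fact k) = 1 / fact k * (of_rat x :: 'f)" for x k
      by (simp add: of_rat_divide)
    then show ?thesis
      by (simp only: nc_exp_nth_extend[OF assms that] of_rat_sum nc_const_sum nc_const_mult)
  qed
  have "subst (nc_exp p) $ m $ n = (\<Sum>w\<in>?W. \<Sum>k\<le>m + n.
      nc_const (1 / fact k) * (nc_const (of_rat (nc_nth (p ^ k) w)) * word_prod w $ m $ n))"
    by (simp add: subst_def coeff sum_distrib_right mult.assoc)
  also have "\<dots> = (\<Sum>k\<le>m + n. \<Sum>w\<in>?W.
      nc_const (1 / fact k) * (nc_const (of_rat (nc_nth (p ^ k) w)) * word_prod w $ m $ n))"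
    by (rule sum.swap)
  also have "\<dots> = ps_exp (subst p) $ m $ n"
    unfolding ps_exp_def ps2_nth subst_power[symmetric] by (simp add: subst_def sum_distrib_left)
  finally show "subst (nc_exp p) $ m $ n = ps_exp (subst p) $ m $ n" .
qed

text \<open>A word with more than \<open>m\<close> letters \<open>a\<close> or more than
  \<open>n\<close> letters \<open>b\<close> contributes nothing here; this matches the finite double
  sum in \<open>cbh_map\<close>.\<close>

lemma subst_bihom_parts:
  "subst p $ m $ n = (\<Sum>j\<le>m. \<Sum>k\<le>n. subst (bihom_part j k p) $ m $ n)"
proof -
  let ?W = "{w :: symb list. length w \<le> m + n}"
  define T where "T w = nc_const (of_rat (nc_nth p w)) * word_prod w $ m $ n" for w
  have part: "nc_const (of_rat (nc_nth (bihom_part j k p) w)) * word_prod w $ m $ n =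
      (if j = count_list w SymA then if k = count_list w SymB then T w else 0 else 0)" for j k w
    by (auto simp: bihom_part_nth T_def)
  have "(\<Sum>j\<le>m. \<Sum>k\<le>n. subst (bihom_part j k p) $ m $ n) =
      (\<Sum>j\<le>m. \<Sum>w\<in>?W. \<Sum>k\<le>n. if j = count_list w SymA then if k = count_list w SymB then T w else 0 else 0)"
    unfolding subst_def ps2_nth part by (intro sum.cong refl sum.swap)
  also have "\<dots> =
      (\<Sum>w\<in>?W. \<Sum>j\<le>m. \<Sum>k\<le>n. if j = count_list w SymA then if k = count_list w SymB then T w else 0 else 0)"
    by (rule sum.swap)
  also have "\<dots> = (\<Sum>w\<in>?W. T w)"
  proof (intro sum.cong refl)
    fix w
    have "(\<Sum>j\<le>m. \<Sum>k\<le>n. if j = count_list w SymA then if k = count_list w SymB then T w else 0 else 0) =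
        (\<Sum>j\<le>m. if j = count_list w SymA then if count_list w SymB \<le> n then T w else 0 else 0)"
      by (intro sum.cong refl) simp
    also have "\<dots> = T w"
      using word_prod_eq_0[of m w n] by (auto simp: T_def not_le)
    finally show "(\<Sum>j\<le>m. \<Sum>k\<le>n. if j = count_list w SymA then if k = count_list w SymB then T w else 0 else 0) = T w" .
  qed
  finally show ?thesis by (simp add: subst_def T_def)
qed

end

section \<open>The universal enveloping algebra\<close>

lemma nc_poly_const [simp]: "nc_poly (nc_const c)"
  unfolding nc_poly_def nc_nth_const by (rule finite_subset[of _ "{[]}"]) auto

lemma nc_poly_var [simp]: "nc_poly (nc_var x)"
  unfolding nc_poly_def nc_nth_var by (rule finite_subset[of _ "{[x]}"]) auto

lemma nc_poly_0 [simp]: "nc_poly 0"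
  by (simp add: nc_poly_def)

lemma nc_poly_add: "nc_poly p \<Longrightarrow> nc_poly q \<Longrightarrow> nc_poly (p + q)"
  unfolding nc_poly_def by (erule (1) finite_subset[OF _ finite_UnI, rotated]) auto

lemma nc_poly_sum: "(\<And>x. x \<in> A \<Longrightarrow> nc_poly (f x)) \<Longrightarrow> nc_poly (sum f A)"
  by (induction A rule: infinite_finite_induct) (auto simp: nc_poly_add)

lemma nc_poly_mult:
  assumes "nc_poly p" "nc_poly q"
  shows "nc_poly (p * q)"
proof -
  let ?S = "\<lambda>p. {w. nc_nth p w \<noteq> 0}"
  have "?S (p * q) \<subseteq> (\<lambda>(u, v). u @ v) ` (?S p \<times> ?S q)"
  proof
    fix w
    assume "w \<in> ?S (p * q)"
    then obtain i where "nc_nth p (take i w) * nc_nth q (drop i w) \<noteq> 0"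
      unfolding nc_nth_mult mem_Collect_eq by (meson sum.neutral)
    then have "(take i w, drop i w) \<in> ?S p \<times> ?S q" by auto
    then show "w \<in> (\<lambda>(u, v). u @ v) ` (?S p \<times> ?S q)" by (rule rev_image_eqI) simp
  qed
  then show ?thesis using assms unfolding nc_poly_def by (meson finite_SigmaI finite_imageI finite_subset)
qed

text \<open>The ideal absorbs multiplication by polynomials, not by arbitrary noncommutative series,
  so finiteness of all coefficients is tracked.\<close>

definition ps_poly :: "('x, 'c::ring_1) ncfps fps fps \<Rightarrow> bool" where
  "ps_poly X \<longleftrightarrow> (\<forall>i j. nc_poly (X $ i $ j))"

lemma ps_poly_one: "ps_poly 1"
  using nc_poly_const[of 1] by (auto simp: ps_poly_def)

lemma ps_poly_mult: "ps_poly X \<Longrightarrow> ps_poly Y \<Longrightarrow> ps_poly (X * Y)"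
  by (auto simp: ps_poly_def ps_mult_nth intro!: nc_poly_sum nc_poly_mult)

lemma ps_poly_power: "ps_poly X \<Longrightarrow> ps_poly (X ^ n)"
  by (induction n) (auto intro: ps_poly_one ps_poly_mult)

lemma ps_poly_exp: "ps_poly X \<Longrightarrow> ps_poly (ps_exp X)"
  using ps_poly_power[of X]
  by (auto simp: ps_poly_def ps_exp_def intro!: nc_poly_sum nc_poly_mult)

lemma ps_poly_map_var: "ps_poly (ps_map nc_var x)"
  by (simp add: ps_poly_def)

lemma (in ps_substitution) ps_poly_subst:
  assumes "ps_poly X" "ps_poly Y"
  shows "ps_poly (subst p)"
proof -
  have "ps_poly (word_prod w)" for w
    using assms by (induction w) (auto intro!: ps_poly_one ps_poly_mult split: symb.split)
  then show ?thesis
    by (auto simp: ps_poly_def subst_def intro!: nc_poly_sum nc_poly_mult)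
qed

context lie_algebra_char_0
begin

abbreviation "\<I> \<equiv> uea_ideal scale br"

lemma uea_ideal_uminus: "p \<in> \<I> \<Longrightarrow> - p \<in> \<I>"
proof -
  assume "p \<in> \<I>"
  then have "nc_const (-1) * p \<in> \<I>" by (rule uea_ideal.left) simp
  moreover have "nc_const (-1) * p = - p" by (rule nc_eqI) simp
  ultimately show ?thesis by simp
qed

lemma uea_ideal_zero: "0 \<in> \<I>"
  using uea_ideal.left[OF uea_ideal.add nc_poly_0] by simp

lemma uea_ideal_diff: "p \<in> \<I> \<Longrightarrow> q \<in> \<I> \<Longrightarrow> p - q \<in> \<I>"
  using uea_ideal.plus[of p scale br "- q"] uea_ideal_uminus[of q] by simp

lemma uea_ideal_sum: "(\<And>x. x \<in> A \<Longrightarrow> f x \<in> \<I>) \<Longrightarrow> sum f A \<in> \<I>"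
  by (induction A rule: infinite_finite_induct) (auto intro: uea_ideal.plus uea_ideal_zero)

section \<open>Congruence modulo the defining ideal\<close>

definition uea_cong :: "('a, 'f) ncfps \<Rightarrow> ('a, 'f) ncfps \<Rightarrow> bool" (infix "\<approx>" 50) where
  "p \<approx> q \<longleftrightarrow> p - q \<in> \<I>"

lemma uea_cong_refl [simp]: "p \<approx> p"
  by (simp add: uea_cong_def uea_ideal_zero)

lemma uea_cong_sym: "p \<approx> q \<Longrightarrow> q \<approx> p"
  using uea_ideal_uminus[of "p - q"] by (simp add: uea_cong_def)

lemma uea_cong_trans [trans]: "p \<approx> q \<Longrightarrow> q \<approx> r \<Longrightarrow> p \<approx> r"
  using uea_ideal.plus[of "p - q" scale br "q - r"] by (simp add: uea_cong_def)

lemma uea_cong_add: "p \<approx> p' \<Longrightarrow> q \<approx> q' \<Longrightarrow> p + q \<approx> p' + q'"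
  using uea_ideal.plus[of "p - p'" scale br "q - q'"] by (simp add: uea_cong_def algebra_simps)

lemma uea_cong_diff: "p \<approx> p' \<Longrightarrow> q \<approx> q' \<Longrightarrow> p - q \<approx> p' - q'"
  using uea_ideal_diff[of "p - p'" "q - q'"] by (simp add: uea_cong_def algebra_simps)

lemma uea_cong_sum: "(\<And>x. x \<in> A \<Longrightarrow> f x \<approx> g x) \<Longrightarrow> sum f A \<approx> sum g A"
  unfolding uea_cong_def sum_subtractf[symmetric] by (rule uea_ideal_sum)

text \<open>The splitting \<open>(p - p') q + p' (q - q')\<close> places exactly the two factors
  known to be polynomials beside the elements of the ideal.\<close>

lemma uea_cong_mult:
  assumes "p \<approx> p'" "q \<approx> q'" "nc_poly p'" "nc_poly q"
  shows "p * q \<approx> p' * q'"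
proof -
  have "(p - p') * q + p' * (q - q') \<in> \<I>"
    using assms unfolding uea_cong_def by (intro uea_ideal.plus uea_ideal.left uea_ideal.right)
  then show ?thesis by (simp add: uea_cong_def algebra_simps)
qed

lemma nc_var_add: "nc_var (x + y) \<approx> nc_var x + nc_var y"
  using uea_ideal.add[of x y scale br] by (simp add: uea_cong_def algebra_simps)

lemma nc_var_scale: "nc_var (scale c x) \<approx> nc_const c * nc_var x"
  using uea_ideal.scale[of scale c x br] by (simp add: uea_cong_def)

lemma nc_var_br: "nc_var x * nc_var y - nc_var y * nc_var x \<approx> nc_var (br x y)"
  using uea_ideal.bracket[of x y br scale] by (simp add: uea_cong_def)

lemma nc_var_zero: "nc_var 0 \<approx> 0"
  using uea_cong_sym[OF nc_var_add[of 0 0]] by (simp add: uea_cong_def)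

lemma nc_var_sum: "nc_var (sum f A) \<approx> (\<Sum>x\<in>A. nc_var (f x))"
proof (induction A rule: infinite_finite_induct)
  case (insert x A)
  have "nc_var (f x + sum f A) \<approx> nc_var (f x) + nc_var (sum f A)" by (rule nc_var_add)
  also have "\<dots> \<approx> nc_var (f x) + (\<Sum>x\<in>A. nc_var (f x))"
    using insert by (intro uea_cong_add) auto
  finally show ?case using insert by simp
qed (auto simp: nc_var_zero)

definition ps_cong :: "('a, 'f) ncfps fps fps \<Rightarrow> ('a, 'f) ncfps fps fps \<Rightarrow> bool" (infix "\<approx>\<^sub>s" 50) where
  "X \<approx>\<^sub>s Y \<longleftrightarrow> (\<forall>i j. X $ i $ j \<approx> Y $ i $ j)"

lemma ps_cong_sym: "X \<approx>\<^sub>s Y \<Longrightarrow> Y \<approx>\<^sub>s X"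
  by (auto simp: ps_cong_def intro: uea_cong_sym)

lemma ps_cong_trans [trans]: "X \<approx>\<^sub>s Y \<Longrightarrow> Y \<approx>\<^sub>s Z \<Longrightarrow> X \<approx>\<^sub>s Z"
  unfolding ps_cong_def by (meson uea_cong_trans)

lemma ps_cong_diff: "X \<approx>\<^sub>s X' \<Longrightarrow> Y \<approx>\<^sub>s Y' \<Longrightarrow> X - Y \<approx>\<^sub>s X' - Y'"
  by (auto simp: ps_cong_def intro: uea_cong_diff)

lemma ps_cong_mult:
  assumes "X \<approx>\<^sub>s X'" "Y \<approx>\<^sub>s Y'" "ps_poly X'" "ps_poly Y"
  shows "X * Y \<approx>\<^sub>s X' * Y'"
  using assms unfolding ps_cong_def ps_mult_nth ps_poly_def
  by (intro allI uea_cong_sum uea_cong_mult) auto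

lemma ps_cong_power:
  assumes "X \<approx>\<^sub>s Y" "ps_poly X" "ps_poly Y"
  shows "X ^ n \<approx>\<^sub>s Y ^ n"
  by (induction n) (use assms in \<open>auto intro!: ps_cong_mult ps_poly_power simp: ps_cong_def[of 1]\<close>)

lemma ps_cong_exp:
  assumes "X \<approx>\<^sub>s Y" "ps_poly X" "ps_poly Y"
  shows "ps_exp X \<approx>\<^sub>s ps_exp Y"
  using ps_cong_power[OF assms] ps_poly_power[of X] assms
  by (auto simp: ps_cong_def ps_exp_def ps_poly_def intro!: uea_cong_sum uea_cong_mult)

lemma map_var_bracket:
  "ps_map nc_var x * ps_map nc_var y - ps_map nc_var y * ps_map nc_var x \<approx>\<^sub>s ps_map nc_var (ps_bracket br x y)"
  unfolding ps_cong_def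
proof (intro allI)
  fix m n :: nat
  have "(ps_map nc_var y * ps_map nc_var x) $ m $ n =
      (\<Sum>i\<le>m. \<Sum>j\<le>n. nc_var (y $ (m - i) $ (n - j)) * nc_var (x $ (m - (m - i)) $ (n - (n - j))))"
    unfolding ps_mult_nth ps_map_nth
    by (subst sum_atMost_rev[symmetric], subst (2) sum_atMost_rev[symmetric]) (rule refl)
  also have "\<dots> = (\<Sum>i\<le>m. \<Sum>j\<le>n. nc_var (y $ (m - i) $ (n - j)) * nc_var (x $ i $ j))"
    by (intro sum.cong refl) simp
  finally have commutator: "(ps_map nc_var x * ps_map nc_var y - ps_map nc_var y * ps_map nc_var x) $ m $ n =
      (\<Sum>i\<le>m. \<Sum>j\<le>n. nc_var (x $ i $ j) * nc_var (y $ (m - i) $ (n - j)) -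
        nc_var (y $ (m - i) $ (n - j)) * nc_var (x $ i $ j))"
    by (simp add: ps_mult_nth sum_subtractf)
  have "(ps_map nc_var x * ps_map nc_var y - ps_map nc_var y * ps_map nc_var x) $ m $ n \<approx>
      (\<Sum>i\<le>m. \<Sum>j\<le>n. nc_var (br (x $ i $ j) (y $ (m - i) $ (n - j))))"
    unfolding commutator by (intro uea_cong_sum nc_var_br)
  also have "\<dots> \<approx> (\<Sum>i\<le>m. nc_var (\<Sum>j\<le>n. br (x $ i $ j) (y $ (m - i) $ (n - j))))"
    by (intro uea_cong_sum uea_cong_sym[OF nc_var_sum])
  also have "\<dots> \<approx> nc_var (\<Sum>i\<le>m. \<Sum>j\<le>n. br (x $ i $ j) (y $ (m - i) $ (n - j)))"
    by (rule uea_cong_sym[OF nc_var_sum])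
  finally show "(ps_map nc_var x * ps_map nc_var y - ps_map nc_var y * ps_map nc_var x) $ m $ n \<approx>
      ps_map nc_var (ps_bracket br x y) $ m $ n"
    by (simp add: ps_bracket_nth)
qed

text \<open>Substitution commutes with products and exponentials, so it carries
  \<open>e^a e^b = e^cbh\<close> to the free algebra over \<open>g\<close>; congruence then replaces
  the substituted Lie series by \<open>cbh_map\<close>.\<close>

lemma uea_exp_mult_uea_exp:
  assumes x0: "\<And>k. x $ 0 $ k = 0" and y0: "\<And>k. y $ k $ 0 = 0"
  shows "uea_exp x * uea_exp y \<approx>\<^sub>s uea_exp (cbh_map scale br x y)"
proof -
  text \<open>
    As \<open>nc_var 0\<close> is not zero in the free algebra, the series \<open>x, y\<close> are represented by series that are
    divisible by \<open>s\<close> and \<open>t\<close>.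
  \<close>
  define X where "X = ps2 (\<lambda>i j. if i = 0 then 0 else nc_var (x $ i $ j) :: ('a, 'f) ncfps)"
  define Y where "Y = ps2 (\<lambda>i j. if j = 0 then 0 else nc_var (y $ i $ j) :: ('a, 'f) ncfps)"
  interpret ps_substitution X Y by unfold_locales (simp_all add: X_def Y_def)
  have poly: "ps_poly X" "ps_poly Y" by (simp_all add: ps_poly_def X_def Y_def)
  have X: "X \<approx>\<^sub>s ps_map nc_var x" and Y: "Y \<approx>\<^sub>s ps_map nc_var y"
    using uea_cong_sym[OF nc_var_zero] by (simp_all add: ps_cong_def X_def Y_def x0 y0)
  \<comment> \<open>The defining relations \<open>add\<close>, \<open>scale\<close> and
    \<open>bracket\<close> move \<open>nc_var\<close> through the three operations of a Lie
    expression, coefficient by coefficient.\<close>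
  have lie: "subst (nc_of_lie e) \<approx>\<^sub>s ps_map nc_var (eval_lie_expr scale br x y e)" for e
  proof (induction e)
    case LieA
    then show ?case by (simp add: subst_var X)
  next
    case LieB
    then show ?case by (simp add: subst_var Y)
  next
    case (LieAdd d e)
    then show ?case
      by (auto simp: ps_cong_def subst_add intro: uea_cong_trans[OF uea_cong_add uea_cong_sym[OF nc_var_add]])
  next
    case (LieScale c e)
    then show ?case
      by (auto simp: ps_cong_def subst_const_mult
        intro: uea_cong_trans[OF uea_cong_mult uea_cong_sym[OF nc_var_scale]]
        ps_poly_subst[OF poly, unfolded ps_poly_def, rule_format])
  next
    case (LieBr d e)
    have "subst (nc_of_lie (LieBr d e)) \<approx>\<^sub>s
        ps_map nc_var (eval_lie_expr scale br x y d) * ps_map nc_var (eval_lie_expr scale br x y e) -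
        ps_map nc_var (eval_lie_expr scale br x y e) * ps_map nc_var (eval_lie_expr scale br x y d)"
      unfolding nc_of_lie.simps subst_diff subst_mult
      by (intro ps_cong_diff ps_cong_mult LieBr.IH ps_poly_map_var ps_poly_subst poly)
    also have "\<dots> \<approx>\<^sub>s ps_map nc_var (eval_lie_expr scale br x y (LieBr d e))"
      unfolding eval_lie_expr.simps by (rule map_var_bracket)
    finally show ?case .
  qed
  have part: "subst (bihom_part j k cbh) $ m $ n \<approx>
      nc_var (eval_lie_poly scale br (bihom_part j k cbh) x y $ m $ n)" for j k m n
  proof -
    obtain e where "bihom_part j k cbh = nc_of_lie e"
      using lie_series_cbh unfolding lie_series_def by blast
    then show ?thesis
      using lie[of e] by (simp add: ps_cong_def eval_lie_poly_nc_of_lie)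
  qed
  have cbh: "subst cbh \<approx>\<^sub>s ps_map nc_var (cbh_map scale br x y)"
    unfolding ps_cong_def
  proof (intro allI)
    fix m n :: nat
    let ?H = "\<lambda>j k. eval_lie_poly scale br (bihom_part j k cbh) x y $ m $ n"
    have "subst cbh $ m $ n \<approx> (\<Sum>j\<le>m. \<Sum>k\<le>n. nc_var (?H j k))"
      unfolding subst_bihom_parts[of cbh] by (intro uea_cong_sum part)
    also have "\<dots> \<approx> (\<Sum>j\<le>m. nc_var (\<Sum>k\<le>n. ?H j k))"
      by (intro uea_cong_sum uea_cong_sym[OF nc_var_sum])
    also have "\<dots> \<approx> nc_var (\<Sum>j\<le>m. \<Sum>k\<le>n. ?H j k)"
      by (rule uea_cong_sym[OF nc_var_sum])
    finally show "subst cbh $ m $ n \<approx> ps_map nc_var (cbh_map scale br x y) $ m $ n"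
      by (simp add: cbh_map_nth)
  qed
  have "uea_exp x * uea_exp y \<approx>\<^sub>s ps_exp X * ps_exp Y"
    unfolding uea_exp_eq_ps_exp
    by (intro ps_cong_mult ps_cong_exp ps_cong_sym[OF X] ps_cong_sym[OF Y] ps_poly_map_var poly ps_poly_exp)
  also have "ps_exp X * ps_exp Y = subst (nc_exp (nc_var SymA) * nc_exp (nc_var SymB))"
    by (simp add: subst_mult subst_exp nc_nth_var subst_var)
  also have "\<dots> = ps_exp (subst cbh)"
    by (simp add: exp_cbh subst_exp cbh_Nil)
  also have "\<dots> \<approx>\<^sub>s uea_exp (cbh_map scale br x y)"
    unfolding uea_exp_eq_ps_exp
    by (intro ps_cong_exp cbh ps_poly_subst poly ps_poly_map_var)
  finally show ?thesis .
qed

lemma uea_series_eqI: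
  assumes "X \<approx>\<^sub>s Y"
  shows "uea_series scale br X = uea_series scale br Y"
proof -
  have "uea_class scale br p = uea_class scale br q" if "p \<approx> q" for p q
    using uea_cong_trans[OF _ that] uea_cong_trans[OF _ uea_cong_sym[OF that]]
    by (auto simp: uea_class_def uea_cong_def)
  then show ?thesis using assms by (simp add: uea_series_def ps2_eq_iff ps_cong_def)
qed

end

section \<open>The factorization\<close>

lemma (in module) proj_along_eqI:
  assumes "subspace V" "subspace W" "V \<inter> W = {0}" "u \<in> V" "w \<in> W" "x = u + w"
  shows "proj_along V W x = u"
  unfolding proj_along_def
proof (rule the_equality)
  show "u \<in> V \<and> x - u \<in> W" using assms by simp
  fix u'
  assume u': "u' \<in> V \<and> x - u' \<in> W"
  then have "u' - u \<in> V" "w - (x - u') \<in> W"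
    using assms(1,2,4,5) by (simp_all add: subspace_diff)
  moreover have "w - (x - u') = u' - u" by (simp add: assms(6))
  ultimately have "u' - u \<in> V \<inter> W" by simp
  then show "u' = u" using assms(3) by simp
qed

locale decomposed_lie_algebra_char_0 = decomposed_lie_algebra scale br gm gp
  for scale :: "'f::field_char_0 \<Rightarrow> 'a::ab_group_add \<Rightarrow> 'a" and br gm gp

sublocale decomposed_lie_algebra_char_0 \<subseteq> lie_algebra_char_0 scale br
  by unfold_locales

context decomposed_lie_algebra_char_0
begin

abbreviation "P \<equiv> proj_along gm gp"
abbreviation "Q \<equiv> proj_along gp gm"
abbreviation "C \<equiv> cbh_map scale br"

section \<open>The two projections as linear maps\<close>

lemma proj_sum:
  assumes "u \<in> gm" "v \<in> gp"
  shows "P (u + v) = u" "Q (u + v) = v"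
  using proj_along_eqI[OF subspace_gm subspace_gp gm_gp_disjoint assms refl]
    proj_along_eqI[OF subspace_gp subspace_gm _ assms(2,1) add.commute] gm_gp_disjoint
  by (simp_all add: Int_commute)

lemma zero_in [simp]: "0 \<in> gm" "0 \<in> gp"
  using subspace_0 subspace_gm subspace_gp by auto

lemma proj_fixes: "u \<in> gm \<Longrightarrow> P u = u" "v \<in> gp \<Longrightarrow> Q v = v"
  and proj_kills: "v \<in> gp \<Longrightarrow> P v = 0" "u \<in> gm \<Longrightarrow> Q u = 0"
  using proj_sum[of u 0] proj_sum[of 0 v] by auto

lemma proj_in [simp]: "P x \<in> gm" "Q x \<in> gp" and proj_decompose: "P x + Q x = x"
proof -
  obtain u v where "u \<in> gm" "v \<in> gp" "x = u + v" using gm_gp_sum by blast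
  then show "P x \<in> gm" "Q x \<in> gp" "P x + Q x = x" by (simp_all add: proj_sum)
qed

lemma proj_add: "P (x + y) = P x + P y" "Q (x + y) = Q x + Q y"
proof -
  have "(P x + Q x) + (P y + Q y) = (P x + P y) + (Q x + Q y)"
    by (simp only: ac_simps)
  then have "x + y = (P x + P y) + (Q x + Q y)"
    by (simp only: proj_decompose)
  moreover have "P x + P y \<in> gm" "Q x + Q y \<in> gp"
    using subspace_gm subspace_gp by (auto intro: subspace_add)
  ultimately show "P (x + y) = P x + P y" "Q (x + y) = Q x + Q y"
    by (simp_all only: proj_sum)
qed

lemma proj_scale: "P (scale c x) = scale c (P x)" "Q (scale c x) = scale c (Q x)"
proof -
  have "scale c x = scale c (P x) + scale c (Q x)"
    by (simp add: scale_right_distrib[symmetric] proj_decompose)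
  moreover have "scale c (P x) \<in> gm" "scale c (Q x) \<in> gp"
    using subspace_gm subspace_gp by (auto intro: subspace_scale)
  ultimately show "P (scale c x) = scale c (P x)" "Q (scale c x) = scale c (Q x)"
    by (simp_all only: proj_sum)
qed

lemma proj_uminus: "P (- x) = - P x" "Q (- x) = - Q x"
  using proj_scale[of "-1" x] by simp_all

lemma proj_diff: "P (x - y) = P x - P y" "Q (x - y) = Q x - Q y"
  using proj_add[of x "- y"] by (simp_all add: proj_uminus)

lemma s_mult_image_iff: "x \<in> s_mult ` series_in gm \<longleftrightarrow> (\<forall>j. x $ 0 $ j = 0) \<and> (\<forall>i j. x $ i $ j \<in> gm)"
proof
  assume "(\<forall>j. x $ 0 $ j = 0) \<and> (\<forall>i j. x $ i $ j \<in> gm)"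
  then show "x \<in> s_mult ` series_in gm"
    by (intro image_eqI[of _ _ "ps2 (\<lambda>i j. x $ Suc i $ j)"])
      (auto simp: ps2_eq_iff st_mult_nth series_in_def Suc_le_eq)
qed (auto simp: st_mult_nth series_in_def)

lemma t_mult_image_iff: "y \<in> t_mult ` series_in gp \<longleftrightarrow> (\<forall>i. y $ i $ 0 = 0) \<and> (\<forall>i j. y $ i $ j \<in> gp)"
proof
  assume "(\<forall>i. y $ i $ 0 = 0) \<and> (\<forall>i j. y $ i $ j \<in> gp)"
  then show "y \<in> t_mult ` series_in gp"
    by (intro image_eqI[of _ _ "ps2 (\<lambda>i j. y $ i $ Suc j)"])
      (auto simp: ps2_eq_iff st_mult_nth series_in_def Suc_le_eq)
qed (auto simp: st_mult_nth series_in_def)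

abbreviation "Sm \<equiv> s_mult ` series_in gm"
abbreviation "Tp \<equiv> t_mult ` series_in gp"

lemma Sm_Int_Tp: "Sm \<inter> Tp = {0}"
proof -
  have "x = 0" if "x \<in> Sm" "x \<in> Tp" for x
    using that gm_gp_disjoint unfolding s_mult_image_iff t_mult_image_iff ps2_eq_iff by auto
  moreover have "0 \<in> Sm" "0 \<in> Tp"
    unfolding s_mult_image_iff t_mult_image_iff by simp_all
  ultimately show ?thesis by blast
qed

text \<open>Membership constrains only coefficients free of \<open>s\<close> or of \<open>t\<close>;
  all others are arbitrary because the two subspaces span. On these boundary coefficients
  \<open>C x y\<close> coincides with \<open>x\<close> and \<open>y\<close>, which gives the
  codomain.\<close>

lemma Sm_plus_Tp_iff:
  "v \<in> {x + y | x y. x \<in> Sm \<and> y \<in> Tp} \<longleftrightarrow>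
    v $ 0 $ 0 = 0 \<and> (\<forall>i. v $ i $ 0 \<in> gm) \<and> (\<forall>j. v $ 0 $ j \<in> gp)"
proof
  assume v: "v $ 0 $ 0 = 0 \<and> (\<forall>i. v $ i $ 0 \<in> gm) \<and> (\<forall>j. v $ 0 $ j \<in> gp)"
  have "ps_map P v \<in> Sm" "ps_map Q v \<in> Tp" "v = ps_map P v + ps_map Q v"
    using v unfolding s_mult_image_iff t_mult_image_iff
    by (auto simp: proj_kills proj_decompose ps2_eq_iff)
  then show "v \<in> {x + y | x y. x \<in> Sm \<and> y \<in> Tp}" by blast
next
  assume "v \<in> {x + y | x y. x \<in> Sm \<and> y \<in> Tp}"
  then obtain x y where "v = x + y" "x \<in> Sm" "y \<in> Tp" by blast
  then show "v $ 0 $ 0 = 0 \<and> (\<forall>i. v $ i $ 0 \<in> gm) \<and> (\<forall>j. v $ 0 $ j \<in> gp)"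
    unfolding s_mult_image_iff t_mult_image_iff by simp
qed

lemma cbh_map_in:
  assumes "x \<in> Sm" "y \<in> Tp"
  shows "C x y \<in> {x + y | x y. x \<in> Sm \<and> y \<in> Tp}"
  unfolding Sm_plus_Tp_iff using assms unfolding s_mult_image_iff t_mult_image_iff
  by (simp add: cbh_map_nth_0_right cbh_map_nth_0_left)

text \<open>By induction on the total degree the nonlinear parts agree, so the coefficients of
  \<open>x + y\<close> and \<open>x' + y'\<close> agree, and the projections separate the
  summands.\<close>

lemma cbh_map_inj:
  assumes "x \<in> Sm" "y \<in> Tp" "x' \<in> Sm" "y' \<in> Tp" "C x y = C x' y'"
  shows "x = x' \<and> y = y'"
proof -
  note mem = assms(1-4)[unfolded s_mult_image_iff t_mult_image_iff]
  have "x $ m $ n = x' $ m $ n \<and> y $ m $ n = y' $ m $ n" for m n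
  proof (induction "m + n" arbitrary: m n rule: less_induct)
    case less
    have "ps_agree (m + n) x x'" "ps_agree (m + n) y y'"
      using less by (auto simp: ps_agree_def)
    then have "(C x y - x - y) $ m $ n = (C x' y' - x' - y') $ m $ n"
      by (rule cbh_map_contraction) (use mem in auto)
    then have "x $ m $ n + y $ m $ n = x' $ m $ n + y' $ m $ n"
      by (simp add: assms(5) algebra_simps)
    then show ?case
      using mem proj_sum[of "x $ m $ n" "y $ m $ n"] proj_sum[of "x' $ m $ n" "y' $ m $ n"] by simp
  qed
  then show ?thesis by (simp add: ps2_eq_iff)
qed

text \<open>The unknown is the single series \<open>f = x + y\<close>, with \<open>x\<close> and
  \<open>y\<close> read off by projection; the equation becomes
  \<open>f = u - (C x y - x - y)\<close>.\<close>

lemma cbh_map_surj: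
  assumes "u \<in> {x + y | x y. x \<in> Sm \<and> y \<in> Tp}"
  obtains x y where "x \<in> Sm" "y \<in> Tp" "C x y = u"
proof -
  note u = assms[unfolded Sm_plus_Tp_iff]
  \<comment> \<open>These boundary conditions force the projections to be divisible by
    \<open>s\<close> and \<open>t\<close>, as the contraction estimate requires; at (0,0) they leave
    only 0.\<close>
  define S where "S ij = (case ij of (i, j) \<Rightarrow> {c. (i = 0 \<longrightarrow> c \<in> gp) \<and> (j = 0 \<longrightarrow> c \<in> gm)})"
    for ij :: "nat \<times> nat"
  define xs where "xs f = ps2 (\<lambda>i j. P (f (i, j)))" for f :: "nat \<times> nat \<Rightarrow> 'a"
  define ys where "ys f = ps2 (\<lambda>i j. Q (f (i, j)))" for f :: "nat \<times> nat \<Rightarrow> 'a"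
  define F where "F f = (\<lambda>(i, j). u $ i $ j - (C (xs f) (ys f) - xs f - ys f) $ i $ j)" for f
  have xs: "xs f $ 0 $ j = 0" and ys: "ys f $ i $ 0 = 0" if "\<forall>ij. f ij \<in> S ij" for f i j
    using that by (auto simp: xs_def ys_def S_def proj_kills split: prod.splits)
  obtain f where f: "\<forall>ij. f ij \<in> S ij" "F f = f"
  proof (rule graded_fixpoint[of S F "\<lambda>_. 0" "\<lambda>(i, j). i + j"])
    show "\<forall>ij. F f ij \<in> S ij" if "\<forall>ij. f ij \<in> S ij" for f
      using u xs[OF that] ys[OF that]
      by (auto simp: F_def S_def cbh_map_nth_0_right cbh_map_nth_0_left)
    show "F f ij = F g ij" if "\<forall>ij. f ij \<in> S ij" "\<forall>ij. g ij \<in> S ij"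
      "\<And>kl. (case kl of (i, j) \<Rightarrow> i + j) < (case ij of (i, j) \<Rightarrow> i + j) \<Longrightarrow> f kl = g kl" for f g ij
    proof -
      obtain i j where ij: "ij = (i, j)" by fastforce
      have "ps_agree (i + j) (xs f) (xs g)" "ps_agree (i + j) (ys f) (ys g)"
        using that(3) by (auto simp: ps_agree_def xs_def ys_def ij)
      then have "(C (xs f) (ys f) - xs f - ys f) $ i $ j = (C (xs g) (ys g) - xs g - ys g) $ i $ j"
        by (rule cbh_map_contraction) (use that(1,2) xs ys in auto)
      then show ?thesis by (simp add: F_def ij)
    qed
  qed (simp add: S_def split: prod.split)
  have "C (xs f) (ys f) = u"
    unfolding ps2_eq_iff
  proof (intro allI)
    fix i j
    have "f (i, j) = u $ i $ j - (C (xs f) (ys f) $ i $ j - xs f $ i $ j - ys f $ i $ j)"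
      using fun_cong[OF f(2), of "(i, j)"] by (simp add: F_def)
    moreover have "xs f $ i $ j + ys f $ i $ j = f (i, j)"
      by (simp add: xs_def ys_def proj_decompose)
    ultimately show "C (xs f) (ys f) $ i $ j = u $ i $ j" by (simp add: algebra_simps)
  qed
  moreover have "xs f \<in> Sm" "ys f \<in> Tp"
    unfolding s_mult_image_iff t_mult_image_iff using xs[OF f(1)] ys[OF f(1)]
    by (auto simp: xs_def ys_def)
  ultimately show thesis by (rule that[rotated 2])
qed

lemma bij_betw_cbh_map:
  "bij_betw (\<lambda>(x, y). C x y) (Sm \<times> Tp) {x + y | x y. x \<in> Sm \<and> y \<in> Tp}"
proof (rule bij_betw_imageI)
  show "inj_on (\<lambda>(x, y). C x y) (Sm \<times> Tp)"
  proof (rule inj_onI)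
    fix p q
    assume pq: "p \<in> Sm \<times> Tp" "q \<in> Sm \<times> Tp" "(\<lambda>(x, y). C x y) p = (\<lambda>(x, y). C x y) q"
    obtain x y where p: "p = (x, y)" "x \<in> Sm" "y \<in> Tp" using pq(1) by blast
    obtain x' y' where q: "q = (x', y')" "x' \<in> Sm" "y' \<in> Tp" using pq(2) by blast
    have "C x y = C x' y'" using pq(3) by (simp add: p(1) q(1))
    then show "p = q" using cbh_map_inj[OF p(2,3) q(2,3)] by (simp add: p(1) q(1))
  qed
  show "(\<lambda>(x, y). C x y) ` (Sm \<times> Tp) = {x + y | x y. x \<in> Sm \<and> y \<in> Tp}"
  proof (intro equalityI subsetI)
    fix u
    assume "u \<in> (\<lambda>(x, y). C x y) ` (Sm \<times> Tp)"
    then obtain p where p: "u = (\<lambda>(x, y). C x y) p" "p \<in> Sm \<times> Tp" by (rule imageE)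
    then have "fst p \<in> Sm" "snd p \<in> Tp" "u = C (fst p) (snd p)"
      by (simp_all only: mem_Times_iff case_prod_beta)
    then show "u \<in> {x + y | x y. x \<in> Sm \<and> y \<in> Tp}" by (simp only: cbh_map_in)
  next
    fix u
    assume "u \<in> {x + y | x y. x \<in> Sm \<and> y \<in> Tp}"
    then obtain x y where "x \<in> Sm" "y \<in> Tp" "C x y = u" by (rule cbh_map_surj)
    then show "u \<in> (\<lambda>(x, y). C x y) ` (Sm \<times> Tp)" by (intro image_eqI[of _ _ "(x, y)"]) auto
  qed
qed

section \<open>Lowest order terms of the map and of its inverse\<close>

lemma cbh_map_low_order:
  obtains q where "q $ 0 $ 0 = 0"
    "C (s_mult g) (t_mult g') =
      s_mult g + t_mult g' + st_mult 1 1 (ps_map (scale (1 / 2)) (ps_bracket br g g')) + st_mult 1 1 q"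
proof
  let ?x = "s_mult g" and ?y = "t_mult g'"
  let ?b = "ps_map (scale (1 / 2)) (ps_bracket br g g')"
  \<comment> \<open>Coefficients of \<open>C ?x ?y - ?x - ?y\<close> without \<open>s\<close> or
    without \<open>t\<close> vanish, so shifting both indices loses nothing.\<close>
  define q where "q = ps2 (\<lambda>i j. (C ?x ?y - ?x - ?y - st_mult 1 1 ?b) $ Suc i $ Suc j)"
  have "{..1::nat} = {0, 1}" by auto
  then have "ps_bracket br ?x ?y $ 1 $ 1 = br (g $ 0 $ 0) (g' $ 0 $ 0)"
    by (simp add: ps_bracket_nth st_mult_nth br_simps)
  then show "q $ 0 $ 0 = 0"
    using cbh_map_nth_1_1[of ?x ?y] by (simp add: q_def st_mult_nth ps_bracket_nth)
  show "C ?x ?y = ?x + ?y + st_mult 1 1 ?b + st_mult 1 1 q"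
    unfolding ps2_eq_iff
  proof (intro allI)
    fix m n
    consider "m = 0" | "n = 0" | i j where "m = Suc i" "n = Suc j"
      by (metis not0_implies_Suc)
    then show "C ?x ?y $ m $ n = (?x + ?y + st_mult 1 1 ?b + st_mult 1 1 q) $ m $ n"
    proof cases
      case 1
      then show ?thesis by (simp add: cbh_map_nth_0_left st_mult_nth)
    next
      case 2
      then show ?thesis by (simp add: cbh_map_nth_0_right st_mult_nth)
    next
      case 3
      then show ?thesis by (simp add: st_mult_nth q_def)
    qed
  qed
qed

text \<open>Projecting \<open>s h + t h' = s g + t g' + s t d\<close> gives
  \<open>h = g + t P d\<close> and \<open>h' = g' + s Q d\<close>. Solving for \<open>g\<close> and
  \<open>g'\<close> changes the sign of \<open>d\<close>, which reverses the bracket to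
  \<open>[h', h]\<close>.\<close>

lemma cbh_map_inverse_low_order:
  fixes h h' :: "'a fps fps"
  defines "b \<equiv> ps_map (scale (1 / 2)) (ps_bracket br h' h)"
  assumes h: "h \<in> series_in gm" "h' \<in> series_in gp" and g: "g \<in> series_in gm" "g' \<in> series_in gp"
    and C: "C (s_mult g) (t_mult g') = s_mult h + t_mult h'"
  obtains r r' where "r \<in> series_in gm" "r $ 0 $ 0 = 0" "g = h + t_mult (ps_map P b) + t_mult r"
    "r' \<in> series_in gp" "r' $ 0 $ 0 = 0" "g' = h' + s_mult (ps_map Q b) + s_mult r'"
proof -
  obtain q where q0: "q $ 0 $ 0 = 0" and q: "C (s_mult g) (t_mult g') =
      s_mult g + t_mult g' + st_mult 1 1 (ps_map (scale (1 / 2)) (ps_bracket br g g')) + st_mult 1 1 q"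
    by (rule cbh_map_low_order)
  define d where "d = ps_map (scale (1 / 2)) (ps_bracket br g g') + q"
  have eq: "s_mult h + t_mult h' = s_mult g + t_mult g' + st_mult 1 1 d"
    using q unfolding C by (simp add: ps2_eq_iff d_def st_mult_nth)
  have eq_nth: "s_mult h $ i $ j + t_mult h' $ i $ j =
      s_mult g $ i $ j + t_mult g' $ i $ j + st_mult 1 1 d $ i $ j" for i j
    using arg_cong[OF eq, of "\<lambda>f. f $ i $ j"] by simp
  note mem = h[unfolded series_in_def, simplified, rule_format] g[unfolded series_in_def, simplified, rule_format]
  \<comment> \<open>The remainder compares \<open>- d\<close> with its expected leading term
    \<open>b\<close>; at the origin they agree since \<open>g\<close> and \<open>h\<close>, and
    \<open>g'\<close> and \<open>h'\<close>, have equal constant terms.\<close>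
  define r where "r = ps_map P (- d - b)"
  define r' where "r' = ps_map Q (- d - b)"
  have g_eq: "g = h + t_mult (ps_map P b) + t_mult r"
    unfolding ps2_eq_iff
  proof (intro allI)
    fix i j
    have "P (s_mult h $ Suc i $ j + t_mult h' $ Suc i $ j) =
      P (s_mult g $ Suc i $ j + t_mult g' $ Suc i $ j + st_mult 1 1 d $ Suc i $ j)"
      by (simp only: eq_nth)
    then have "h $ i $ j = g $ i $ j + P (st_mult 1 1 d $ Suc i $ j)"
      by (simp add: proj_add st_mult_nth proj_fixes proj_kills mem split: if_splits)
    then show "g $ i $ j = (h + t_mult (ps_map P b) + t_mult r) $ i $ j"
      by (auto simp: st_mult_nth r_def proj_diff proj_uminus proj_kills)
  qed
  have g'_eq: "g' = h' + s_mult (ps_map Q b) + s_mult r'"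
    unfolding ps2_eq_iff
  proof (intro allI)
    fix i j
    have "Q (s_mult h $ i $ Suc j + t_mult h' $ i $ Suc j) =
      Q (s_mult g $ i $ Suc j + t_mult g' $ i $ Suc j + st_mult 1 1 d $ i $ Suc j)"
      by (simp only: eq_nth)
    then have "h' $ i $ j = g' $ i $ j + Q (st_mult 1 1 d $ i $ Suc j)"
      by (simp add: proj_add st_mult_nth proj_fixes proj_kills mem split: if_splits)
    then show "g' $ i $ j = (h' + s_mult (ps_map Q b) + s_mult r') $ i $ j"
      by (auto simp: st_mult_nth r'_def proj_diff proj_uminus proj_kills)
  qed
  have "g $ 0 $ 0 = h $ 0 $ 0" "g' $ 0 $ 0 = h' $ 0 $ 0"
    by (simp_all add: g_eq g'_eq st_mult_nth)
  then have "(- d - b) $ 0 $ 0 = 0"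
    using br_anticommute[of "h $ 0 $ 0" "h' $ 0 $ 0"] by (simp add: d_def b_def ps_bracket_nth q0)
  then have "r $ 0 $ 0 = 0" "r' $ 0 $ 0 = 0"
    by (simp_all add: r_def r'_def proj_kills del: fps_sub_nth fps_neg_nth)
  moreover have "r \<in> series_in gm" "r' \<in> series_in gp"
    by (simp_all add: series_in_def r_def r'_def)
  ultimately show thesis using g_eq g'_eq by (intro that)
qed

end

theorem theorem3p1:
  fixes scale :: "'f::field_char_0 \<Rightarrow> 'a::ab_group_add \<Rightarrow> 'a"
    and br :: "'a \<Rightarrow> 'a \<Rightarrow> 'a" and gm gp :: "'a set"
  assumes "decomposed_lie_algebra scale br gm gp"
  defines "C \<equiv> cbh_map scale br"
    and "B \<equiv> ps_bracket br"
    and "half \<equiv> ps_map (scale (1 / 2))"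
    and "pm \<equiv> ps_map (proj_along gm gp)"
    and "pp \<equiv> ps_map (proj_along gp gm)"
    and "Sm \<equiv> s_mult ` series_in gm"
    and "Tp \<equiv> t_mult ` series_in gp"
  shows "Sm \<inter> Tp = {0} \<and>
    bij_betw (\<lambda>(x, y). C x y) (Sm \<times> Tp) {x + y | x y. x \<in> Sm \<and> y \<in> Tp} \<and>
    (\<forall>g\<in>series_in gm. \<forall>g'\<in>series_in gp.
      uea_series scale br (uea_exp (s_mult g) * uea_exp (t_mult g')) =
      uea_series scale br (uea_exp (C (s_mult g) (t_mult g')))) \<and>
    (\<forall>g\<in>series_in gm. \<forall>g'\<in>series_in gp. \<exists>q. q $ 0 $ 0 = 0 \<and>
      C (s_mult g) (t_mult g') =
        s_mult g + t_mult g' + st_mult 1 1 (half (B g g')) + st_mult 1 1 q) \<and>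
    (\<forall>h\<in>series_in gm. \<forall>h'\<in>series_in gp.
      \<exists>g\<in>series_in gm. \<exists>g'\<in>series_in gp.
        the_inv_into (Sm \<times> Tp) (\<lambda>(x, y). C x y) (s_mult h + t_mult h') = (s_mult g, t_mult g') \<and>
        (\<exists>r\<in>series_in gm. r $ 0 $ 0 = 0 \<and>
          g = h + t_mult (half (pm (B h' h))) + t_mult r) \<and>
        (\<exists>r\<in>series_in gp. r $ 0 $ 0 = 0 \<and>
          g' = h' + s_mult (half (pp (B h' h))) + s_mult r))"
proof -
  interpret L: decomposed_lie_algebra_char_0 scale br gm gp
    using assms(1) by (rule decomposed_lie_algebra_char_0.intro)
  have bij: "bij_betw (\<lambda>(x, y). C x y) (Sm \<times> Tp) {x + y | x y. x \<in> Sm \<and> y \<in> Tp}"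
    unfolding C_def Sm_def Tp_def by (rule L.bij_betw_cbh_map)
  have disjoint: "Sm \<inter> Tp = {0}"
    unfolding Sm_def Tp_def by (rule L.Sm_Int_Tp)
  have exp: "uea_series scale br (uea_exp (s_mult g) * uea_exp (t_mult g')) =
      uea_series scale br (uea_exp (C (s_mult g) (t_mult g')))" for g g'
    unfolding C_def by (intro L.uea_series_eqI L.uea_exp_mult_uea_exp) (simp_all add: st_mult_nth)
  have low: "\<exists>q. q $ 0 $ 0 = 0 \<and> C (s_mult g) (t_mult g') =
      s_mult g + t_mult g' + st_mult 1 1 (half (B g g')) + st_mult 1 1 q" for g g'
    unfolding C_def half_def B_def by (rule L.cbh_map_low_order[of g g']) blast
  have inverse: "\<exists>g\<in>series_in gm. \<exists>g'\<in>series_in gp.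
      the_inv_into (Sm \<times> Tp) (\<lambda>(x, y). C x y) (s_mult h + t_mult h') = (s_mult g, t_mult g') \<and>
      (\<exists>r\<in>series_in gm. r $ 0 $ 0 = 0 \<and> g = h + t_mult (half (pm (B h' h))) + t_mult r) \<and>
      (\<exists>r\<in>series_in gp. r $ 0 $ 0 = 0 \<and> g' = h' + s_mult (half (pp (B h' h))) + s_mult r)"
    if h: "h \<in> series_in gm" "h' \<in> series_in gp" for h h'
  proof -
    have "s_mult h + t_mult h' \<in> {x + y | x y. x \<in> Sm \<and> y \<in> Tp}"
      using h unfolding Sm_def Tp_def by blast
    then obtain x y where xy: "x \<in> Sm" "y \<in> Tp" "C x y = s_mult h + t_mult h'"
      unfolding C_def Sm_def Tp_def by (rule L.cbh_map_surj)
    then obtain g g' where g: "g \<in> series_in gm" "g' \<in> series_in gp" "x = s_mult g" "y = t_mult g'"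
      unfolding Sm_def Tp_def by blast
    have inv: "the_inv_into (Sm \<times> Tp) (\<lambda>(x, y). C x y) (s_mult h + t_mult h') = (s_mult g, t_mult g')"
      using xy g by (intro the_inv_into_f_eq bij_betw_imp_inj_on[OF bij]) auto
    \<comment> \<open>The theorem halves after projecting, the lemma before; linearity of the
      projections reconciles the two.\<close>
    have half_pm: "half (pm f) = ps_map L.P (half f)" and half_pp: "half (pp f) = ps_map L.Q (half f)" for f
      by (simp_all add: half_def pm_def pp_def ps2_eq_iff L.proj_scale)
    have "C (s_mult g) (t_mult g') = s_mult h + t_mult h'" using xy g by simp
    from L.cbh_map_inverse_low_order[OF h g(1,2) this[unfolded C_def]]
    obtain r r' where "r \<in> series_in gm" "r $ 0 $ 0 = 0" "g = h + t_mult (half (pm (B h' h))) + t_mult r"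
      "r' \<in> series_in gp" "r' $ 0 $ 0 = 0" "g' = h' + s_mult (half (pp (B h' h))) + s_mult r'"
      unfolding half_pm half_pp unfolding half_def B_def .
    then show ?thesis
      by (intro bexI[of _ g] bexI[of _ g'] bexI[of _ r] bexI[of _ r'] conjI inv g)
  qed
  show ?thesis
    by (intro conjI ballI disjoint bij exp low inverse)
qed

end
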